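(* Let $M$ be a smooth compact manifold without boundary, of dimension $d\ge 1$, and let $g$ be a $C^2$ Riemannian metric on $M$. Fix $t>0$. For $p\in C(M)$ with $p>0$ on $M$, define the operator $L^{(g)}_{t,p}$ on $C(M)$ by $$(L^{(g)}_{t,p} f)(x):=\frac{1}{t^{\frac d2+1}}\int_M \exp\Big(-\frac{d_g(x,y)^2}{t}\Big)\,\bigl(f(x)-f(y)\bigr)\,p(y)\,d\mu_g(y),\qquad f\in C(M),\ x\in M.$$ If $p_1,p_2\in C(M)$ are strictly positive and $L^{(g)}_{t,p_1}=L^{(g)}_{t,p_2}$ as operators on $C(M)$, then $p_1=p_2$.
   Context: $C(M)$ denotes the space of continuous real-valued functions on $M$. For a Riemannian metric $g$ on $M$, $d_g$ denotes the geodesic (intrinsic) distance induced by $g$, i.e. the infimum of $g$-lengths of piecewise $C^1$ curves joining two points (if $M$ is disconnected, $d_g(x,y)=+\infty$ for points in different components and $\exp(-\infty)=0$), and $\mu_g$ denotes the Riemannian volume measure of $g$. *)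

theory Defs
  imports "HOL-Analysis.Analysis"
begin

section \<open>Functions of class \<open>C\<^sup>k\<close> on an open set\<close>

text \<open>Only meaningful for open \<open>S\<close>: all iterated directional derivatives up to order \<open>k\<close> exist
  and are continuous.\<close>

primrec Ck_on ::
  "nat \<Rightarrow> ('e::euclidean_space \<Rightarrow> 'b::real_normed_vector) \<Rightarrow> 'e set \<Rightarrow> bool" where
  "Ck_on 0 f S \<longleftrightarrow> continuous_on S f"
| "Ck_on (Suc k) f S \<longleftrightarrow>
     (\<forall>x\<in>S. f differentiable (at x)) \<and>
     (\<forall>v. Ck_on k (\<lambda>x. frechet_derivative f (at x) v) S)"

definition smooth_on ::
  "('e::euclidean_space \<Rightarrow> 'b::real_normed_vector) \<Rightarrow> 'e set \<Rightarrow> bool" where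
  "smooth_on f S \<longleftrightarrow> (\<forall>k. Ck_on k f S)"

section \<open>Smooth manifolds\<close>

text \<open>A chart is a pair of a domain \<open>U\<close> and a coordinate map whose values outside \<open>U\<close> are
  irrelevant. The dimension of the manifold is \<open>CARD('n)\<close>, which is automatically at least 1.\<close>

type_synonym ('a, 'n) chart = "'a set \<times> ('a \<Rightarrow> real ^ 'n)"

definition chart_inv :: "('a, 'n) chart \<Rightarrow> real ^ 'n \<Rightarrow> 'a" where
  "chart_inv c = inv_into (fst c) (snd c)"

definition transition :: "('a, 'n) chart \<Rightarrow> ('a, 'n) chart \<Rightarrow> real ^ 'n \<Rightarrow> real ^ 'n" where
  "transition c c' = snd c' \<circ> chart_inv c"

definition is_chart :: "'a::t2_space set \<Rightarrow> ('a, 'n::finite) chart \<Rightarrow> bool" where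
  "is_chart M c \<longleftrightarrow>
     openin (top_of_set M) (fst c) \<and> open (snd c ` fst c) \<and>
     homeomorphism (fst c) (snd c ` fst c) (snd c) (chart_inv c)"

text \<open>The smooth structure on \<open>M\<close> is the one generated by the (not necessarily maximal) atlas
  \<open>\<A>\<close>. Charts map onto open subsets of \<open>\<real>\<^sup>n\<close>, so there is no boundary.\<close>

definition smooth_manifold :: "'a::t2_space set \<Rightarrow> ('a, 'n::finite) chart set \<Rightarrow> bool" where
  "smooth_manifold M \<A> \<longleftrightarrow>
     second_countable (top_of_set M) \<and>
     (\<forall>c\<in>\<A>. is_chart M c) \<and>
     (\<Union>c\<in>\<A>. fst c) = M \<and>
     (\<forall>c\<in>\<A>. \<forall>c'\<in>\<A>. smooth_on (transition c c') (snd c ` (fst c \<inter> fst c')))"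

section \<open>Tangent vectors\<close>

text \<open>A tangent vector at \<open>x\<close> is the family of its coordinate representations in all charts
  around \<open>x\<close>; these are related by the differentials of the transition maps. Charts that do
  not contain \<open>x\<close> carry the dummy value 0.\<close>

type_synonym ('a, 'n) tvec = "('a, 'n) chart \<Rightarrow> real ^ 'n"

definition charts_at :: "('a, 'n) chart set \<Rightarrow> 'a \<Rightarrow> ('a, 'n) chart set" where
  "charts_at \<A> x = {c\<in>\<A>. x \<in> fst c}"

definition tangent_space :: "('a, 'n::finite) chart set \<Rightarrow> 'a \<Rightarrow> ('a, 'n) tvec set" where
  "tangent_space \<A> x =
     {v. (\<forall>c\<in>charts_at \<A> x. \<forall>c'\<in>charts_at \<A> x.
             v c' = frechet_derivative (transition c c') (at (snd c x)) (v c)) \<and>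
         (\<forall>c. c \<notin> charts_at \<A> x \<longrightarrow> v c = 0)}"

text \<open>The tangent vector at \<open>x\<close> that is represented by \<open>u\<close> in the chart \<open>c\<close>; for \<open>u = axis i 1\<close>
  this is the coordinate vector field \<open>\<partial>\<^sub>i\<close> of \<open>c\<close> at \<open>x\<close>.\<close>

definition coord_vec ::
  "('a, 'n::finite) chart set \<Rightarrow> ('a, 'n) chart \<Rightarrow> 'a \<Rightarrow> real ^ 'n \<Rightarrow> ('a, 'n) tvec" where
  "coord_vec \<A> c x u =
     (\<lambda>c'. if c' \<in> charts_at \<A> x
           then frechet_derivative (transition c c') (at (snd c x)) u else 0)"

section \<open>Riemannian metrics\<close>

type_synonym ('a, 'n) metric = "'a \<Rightarrow> ('a, 'n) tvec \<Rightarrow> ('a, 'n) tvec \<Rightarrow> real"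

definition gram_matrix ::
  "('a, 'n::finite) chart set \<Rightarrow> ('a, 'n) metric \<Rightarrow> ('a, 'n) chart \<Rightarrow> 'a \<Rightarrow> real ^ 'n ^ 'n" where
  "gram_matrix \<A> g c x =
     (\<chi> i j. g x (coord_vec \<A> c x (axis i 1)) (coord_vec \<A> c x (axis j 1)))"

definition inner_product_on_tangent ::
  "('a, 'n::finite) chart set \<Rightarrow> 'a \<Rightarrow> (('a, 'n) tvec \<Rightarrow> ('a, 'n) tvec \<Rightarrow> real) \<Rightarrow> bool" where
  "inner_product_on_tangent \<A> x b \<longleftrightarrow>
     (\<forall>u\<in>tangent_space \<A> x. \<forall>v\<in>tangent_space \<A> x. \<forall>w\<in>tangent_space \<A> x. \<forall>r s.
        b (\<lambda>c. r *\<^sub>R u c + s *\<^sub>R v c) w = r * b u w + s * b v w) \<and>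
     (\<forall>u\<in>tangent_space \<A> x. \<forall>v\<in>tangent_space \<A> x. b u v = b v u) \<and>
     (\<forall>u\<in>tangent_space \<A> x. u \<noteq> (\<lambda>c. 0) \<longrightarrow> b u u > 0)"

text \<open>Metric of class \<open>C\<^sup>k\<close>: the components \<open>g\<^sub>i\<^sub>j\<close> are \<open>C\<^sup>k\<close> in every chart of the atlas.\<close>

definition Ck_riemannian_metric ::
  "nat \<Rightarrow> 'a::t2_space set \<Rightarrow> ('a, 'n::finite) chart set \<Rightarrow> ('a, 'n) metric \<Rightarrow> bool" where
  "Ck_riemannian_metric k M \<A> g \<longleftrightarrow>
     (\<forall>x\<in>M. inner_product_on_tangent \<A> x (g x)) \<and>
     (\<forall>c\<in>\<A>. \<forall>i j. Ck_on k (\<lambda>z. gram_matrix \<A> g c (chart_inv c z) $ i $ j) (snd c ` fst c))"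

section \<open>Curves, length and geodesic distance\<close>

text \<open>\<open>C\<^sup>1\<close> up to (and including) the end points of the interval, with one-sided derivatives
  there.\<close>

definition C1_curve ::
  "'a::t2_space set \<Rightarrow> ('a, 'n::finite) chart set \<Rightarrow> real \<Rightarrow> real \<Rightarrow> (real \<Rightarrow> 'a) \<Rightarrow> bool" where
  "C1_curve M \<A> a b \<gamma> \<longleftrightarrow>
     continuous_on {a..b} \<gamma> \<and> \<gamma> ` {a..b} \<subseteq> M \<and>
     (\<forall>c\<in>\<A>. \<exists>D. continuous_on {s\<in>{a..b}. \<gamma> s \<in> fst c} D \<and>
        (\<forall>s\<in>{a..b}. \<gamma> s \<in> fst c \<longrightarrow>
           (snd c \<circ> \<gamma> has_vector_derivative D s) (at s within {a..b})))"

text \<open>\<open>F\<close> is a finite set containing the interior break points; the closed intervals between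
  consecutive break points are among those considered.\<close>

definition piecewise_C1_curve ::
  "'a::t2_space set \<Rightarrow> ('a, 'n::finite) chart set \<Rightarrow> real \<Rightarrow> real \<Rightarrow> (real \<Rightarrow> 'a) \<Rightarrow> bool" where
  "piecewise_C1_curve M \<A> a b \<gamma> \<longleftrightarrow>
     continuous_on {a..b} \<gamma> \<and> \<gamma> ` {a..b} \<subseteq> M \<and>
     (\<exists>F. finite F \<and>
        (\<forall>s s'. a \<le> s \<and> s < s' \<and> s' \<le> b \<and> {s<..<s'} \<inter> F = {} \<longrightarrow> C1_curve M \<A> s s' \<gamma>))"

definition velocity ::
  "('a, 'n::finite) chart set \<Rightarrow> (real \<Rightarrow> 'a) \<Rightarrow> real \<Rightarrow> ('a, 'n) tvec" where
  "velocity \<A> \<gamma> s =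
     (\<lambda>c. if c \<in> charts_at \<A> (\<gamma> s) then vector_derivative (snd c \<circ> \<gamma>) (at s) else 0)"

text \<open>The velocity may be undefined at the finitely many break points and at the end points,
  which form a null set.\<close>

definition curve_length ::
  "('a, 'n::finite) chart set \<Rightarrow> ('a, 'n) metric \<Rightarrow> real \<Rightarrow> real \<Rightarrow> (real \<Rightarrow> 'a) \<Rightarrow> ennreal" where
  "curve_length \<A> g a b \<gamma> =
     (\<integral>\<^sup>+s\<in>{a..b}. ennreal (sqrt (g (\<gamma> s) (velocity \<A> \<gamma> s) (velocity \<A> \<gamma> s))) \<partial>lborel)"

text \<open>The infimum over the empty set is \<open>\<infinity>\<close>, the value for points in different components.\<close>

definition geodesic_dist ::
  "'a::t2_space set \<Rightarrow> ('a, 'n::finite) chart set \<Rightarrow> ('a, 'n) metric \<Rightarrow> 'a \<Rightarrow> 'a \<Rightarrow> ennreal" where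
  "geodesic_dist M \<A> g x y =
     Inf {curve_length \<A> g a b \<gamma> | a b \<gamma>.
            a \<le> b \<and> piecewise_C1_curve M \<A> a b \<gamma> \<and> \<gamma> a = x \<and> \<gamma> b = y}"

section \<open>Riemannian volume\<close>

text \<open>The unique Borel measure on \<open>M\<close> given by \<open>sqrt (det (g\<^sub>i\<^sub>j)) dz\<close> in every chart.\<close>

definition is_riemannian_volume ::
  "'a::t2_space set \<Rightarrow> ('a, 'n::finite) chart set \<Rightarrow> ('a, 'n) metric \<Rightarrow> 'a measure \<Rightarrow> bool" where
  "is_riemannian_volume M \<A> g \<mu> \<longleftrightarrow>
     sets \<mu> = sets (restrict_space borel M) \<and>
     (\<forall>c\<in>\<A>. \<forall>A\<in>sets \<mu>. A \<subseteq> fst c \<longrightarrow>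
        emeasure \<mu> A =
          (\<integral>\<^sup>+z\<in>snd c ` A. ennreal (sqrt (det (gram_matrix \<A> g c (chart_inv c z)))) \<partial>lborel))"

definition riemannian_volume ::
  "'a::t2_space set \<Rightarrow> ('a, 'n::finite) chart set \<Rightarrow> ('a, 'n) metric \<Rightarrow> 'a measure" where
  "riemannian_volume M \<A> g = (THE \<mu>. is_riemannian_volume M \<A> g \<mu>)"

section \<open>The weighted kernel Laplacian\<close>

text \<open>\<open>exp (- d\<^sup>2 / t)\<close> for an extended distance \<open>d\<close>, with \<open>exp (-\<infinity>) = 0\<close>.\<close>

definition gauss_kernel :: "real \<Rightarrow> ennreal \<Rightarrow> real" where
  "gauss_kernel t d = (if d = \<infinity> then 0 else exp (- ((enn2real d)\<^sup>2 / t)))"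

definition kernel_laplacian ::
  "'a::t2_space set \<Rightarrow> ('a, 'n::finite) chart set \<Rightarrow> ('a, 'n) metric \<Rightarrow> real \<Rightarrow> ('a \<Rightarrow> real) \<Rightarrow>
     ('a \<Rightarrow> real) \<Rightarrow> 'a \<Rightarrow> real" where
  "kernel_laplacian M \<A> g t p f x =
     1 / t powr (real CARD('n) / 2 + 1) *
     (\<integral>y. gauss_kernel t (geodesic_dist M \<A> g x y) * (f x - f y) * p y \<partial>riemannian_volume M \<A> g)"

end

theory Submission
  imports Defs
begin

text \<open>
  Suppose \<open>q = p1 - p2\<close> were positive at some point \<open>x\<close>. Equality of the two operators at \<open>x\<close>,
  applied to a continuous \<open>f\<close> with \<open>f x = 0\<close>, says \<open>\<integral> k f q d\<mu> = 0\<close> where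
  \<open>k y = exp (- d(x, y)\<^sup>2 / t)\<close>. Choose \<open>f \<ge> 0\<close>, not identically zero, supported in a
  neighbourhood \<open>U\<close> of \<open>x\<close> on which \<open>q > 0\<close>; vanishing at \<open>x\<close> is no obstacle because a manifold of
  dimension at least 1 has no isolated points. Then the integrand is nonnegative, and it is
  positive on a nonempty open set as soon as \<open>k > 0\<close> on \<open>U\<close>, a contradiction. So \<open>p1 \<le> p2\<close>, which is
  lemma \<open>weight_le\<close>, and exchanging \<open>p1\<close> and \<open>p2\<close> gives equality.

  The argument needs three geometric inputs.

  The first is that \<open>\<mu>\<close> exists: the Riemannian volume is defined as the unique Borel measure
  with density \<open>sqrt (det g\<^sub>i\<^sub>j)\<close> in every chart. In overlapping charts the Gram matrices are related by
  \<open>G = J\<^sup>T G' J\<close> with the Jacobian \<open>J\<close> of the transition map, so the densities differ by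
  the factor \<open>\<bar>det J\<bar>\<close>, and the change of variables formula shows that the chart measures agree on
  the overlaps (\<open>chart_measure_compatible\<close>). Cutting the compact \<open>M\<close> into finitely many Borel pieces, each
  inside a chart, glues them and also shows uniqueness (\<open>ex1_riemannian_volume\<close>).

  The second is that \<open>\<mu>\<close> is positive on nonempty open sets and finite near every point
  (\<open>emeasure_vol_open_pos\<close>, \<open>locally_finite_vol\<close>), because the density is continuous and positive.

  The third is that \<open>k\<close> is measurable and positive near \<open>x\<close>. Both follow from the openness of
  the sets \<open>{y. d(x, y) < r}\<close> (\<open>openin_gdist_less\<close>), of which the case \<open>r = \<infinity>\<close> gives a neighbourhood of
  \<open>x\<close> at finite distance. A curve that ends at \<open>y\<close> is prolonged to any nearby point by a segment
  that is straight in a chart and whose length is small, since the metric is bounded there.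
\<close>

section \<open>Change of variables for nonnegative integrals\<close>

text \<open>A nonnegative measurable function that is not integrable has integral infinity. Hence an
  equivalence about absolute integrability and the value of the Henstock--Kurzweil integral, such as
  \<open>has_absolute_integral_change_of_variables\<close>, turns into an equality of nonnegative integrals.\<close>

lemma set_nn_integral_eq_integral:
  fixes u :: "'a::euclidean_space \<Rightarrow> real"
  assumes A: "A \<in> sets borel"
    and meas: "u \<in> borel_measurable (restrict_space borel A)"
    and nonneg: "\<And>z. z \<in> A \<Longrightarrow> 0 \<le> u z"
  shows "(\<integral>\<^sup>+z\<in>A. ennreal (u z) \<partial>lborel) =
    (if u absolutely_integrable_on A then ennreal (integral A u) else \<infinity>)"
proof -
  have m: "(\<lambda>z. indicator A z *\<^sub>R u z) \<in> borel_measurable borel"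
    using meas A by (simp add: borel_measurable_restrict_space_iff)
  have eq: "(\<integral>\<^sup>+z\<in>A. ennreal (u z) \<partial>lborel) = (\<integral>\<^sup>+z. ennreal (norm (indicator A z *\<^sub>R u z)) \<partial>lborel)"
    by (rule nn_integral_cong) (use nonneg in \<open>auto simp: indicator_def\<close>)
  show ?thesis
  proof (cases "u absolutely_integrable_on A")
    case True
    then have "(u has_integral integral A u) A"
      using set_lebesgue_integral_eq_integral(1) by blast
    from nn_integral_has_integral_lebesgue'[OF nonneg this] show ?thesis
      using True by simp
  next
    case False
    then have "\<not> integrable lborel (\<lambda>z. indicator A z *\<^sub>R u z)"
      using m by (simp add: set_integrable_def integrable_completion)
    then have "\<not> (\<integral>\<^sup>+z. ennreal (norm (indicator A z *\<^sub>R u z)) \<partial>lborel) < \<infinity>"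
      using m by (simp add: integrable_iff_bounded)
    with False eq show ?thesis by (metis infinity_ennreal_def top.not_eq_extremum)
  qed
qed

lemma nn_integral_change_of_variables_wellorder:
  fixes T :: "real^'m::{finite,wellorder} \<Rightarrow> real^'m::_" and h :: "real^'m::_ \<Rightarrow> real"
  assumes S: "S \<in> sets borel" and TS: "T ` S \<in> sets borel"
    and der: "\<And>z. z \<in> S \<Longrightarrow> (T has_derivative T' z) (at z within S)"
    and inj: "inj_on T S"
    and nonneg: "\<And>z. z \<in> T ` S \<Longrightarrow> 0 \<le> h z"
    and h: "h \<in> borel_measurable (restrict_space borel (T ` S))"
    and hT: "(\<lambda>z. \<bar>det (matrix (T' z))\<bar> * h (T z)) \<in> borel_measurable (restrict_space borel S)"
  shows "(\<integral>\<^sup>+z\<in>T ` S. ennreal (h z) \<partial>lborel) =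
    (\<integral>\<^sup>+z\<in>S. ennreal (\<bar>det (matrix (T' z))\<bar> * h (T z)) \<partial>lborel)"
proof -
  let ?k = "\<lambda>z. \<bar>det (matrix (T' z))\<bar> * h (T z)"
  have "?k absolutely_integrable_on S \<and> integral S ?k = b
      \<longleftrightarrow> h absolutely_integrable_on T ` S \<and> integral (T ` S) h = b" for b
    using has_absolute_integral_change_of_variables[OF _ der inj,
        of "\<lambda>z. vec (h z) :: real^1" "vec b"] S
    by (auto simp: absolutely_integrable_on_1_iff integral_on_1_eq o_def vec_eq_iff)
  then have "(if h absolutely_integrable_on T ` S then ennreal (integral (T ` S) h) else \<infinity>) =
      (if ?k absolutely_integrable_on S then ennreal (integral S ?k) else \<infinity>)"
    by (smt (verit))
  moreover have "(\<integral>\<^sup>+z\<in>S. ennreal (?k z) \<partial>lborel) =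
      (if ?k absolutely_integrable_on S then ennreal (integral S ?k) else \<infinity>)"
    by (rule set_nn_integral_eq_integral[OF S hT]) (use nonneg in auto)
  moreover have "(\<integral>\<^sup>+z\<in>T ` S. ennreal (h z) \<partial>lborel) =
      (if h absolutely_integrable_on T ` S then ennreal (integral (T ` S) h) else \<infinity>)"
    by (rule set_nn_integral_eq_integral[OF TS h nonneg])
  ultimately show ?thesis by (simp only:)
qed

text \<open>A copy of a finite index type that carries a well-order. Renaming the coordinates along the
  bijection changes neither Lebesgue measure (\<open>distr_lborel_reindex\<close>) nor determinants
  (\<open>det_reindex\<close>), so the change of variables formula for well-ordered index types implies the one
  for all finite index types.\<close>

typedef 'n::finite ordered = "UNIV :: 'n::finite set"
  morphisms of_ordered to_ordered by simp

lemma bij_of_ordered: "bij of_ordered"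
  using type_definition.Rep_range[OF type_definition_ordered]
  by (simp add: bij_def inj_def of_ordered_inject)

instance ordered :: (finite) finite
  by standard (simp add: bij_betw_finite[OF bij_of_ordered])

instantiation ordered :: (finite) linorder
begin
definition less_eq_ordered :: "'a ordered \<Rightarrow> 'a ordered \<Rightarrow> bool" where
  "x \<le> y \<longleftrightarrow> to_nat (of_ordered x) \<le> to_nat (of_ordered y)"
definition less_ordered :: "'a ordered \<Rightarrow> 'a ordered \<Rightarrow> bool" where
  "x < y \<longleftrightarrow> to_nat (of_ordered x) < to_nat (of_ordered y)"
instance
  by standard (auto simp: less_eq_ordered_def less_ordered_def of_ordered_inject)
end

instance ordered :: (finite) wellorder
proof
  fix P :: "'a ordered \<Rightarrow> bool" and a
  assume "\<And>x. (\<And>y. y < x \<Longrightarrow> P y) \<Longrightarrow> P x"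
  then show "P a"
    unfolding less_ordered_def
    by (induction a rule: measure_induct_rule[of "\<lambda>x. to_nat (of_ordered x)"]) blast
qed

definition reindex :: "('m \<Rightarrow> 'n) \<Rightarrow> 'a^'n \<Rightarrow> 'a^'m" where
  "reindex f x = (\<chi> i. x $ f i)"

lemma linear_reindex: "linear (reindex f :: real^'n \<Rightarrow> real^'m)"
  by (rule linearI) (simp_all add: reindex_def vec_eq_iff)

lemma reindex_inv:
  assumes "bij f"
  shows "reindex (inv f) (reindex f x) = x" "reindex f (reindex (inv f) y) = y"
  using inv_f_f[OF bij_is_inj[OF assms]] surj_f_inv_f[OF bij_is_surj[OF assms]]
  by (simp_all add: reindex_def vec_eq_iff)

lemma measurable_reindex[measurable]:
  "(reindex f :: real^'n::finite \<Rightarrow> real^'m::finite) \<in> borel_measurable borel"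
  using linear_reindex[of f]
  by (simp add: linear_conv_bounded_linear borel_measurable_continuous_onI linear_continuous_on)

lemma distr_lborel_reindex:
  assumes f: "bij (f :: 'm::finite \<Rightarrow> 'n::finite)"
  shows "distr lborel borel (reindex f :: real^'n \<Rightarrow> real^'m) = lborel"
proof (rule lborel_eqI[symmetric])
  fix l u :: "real^'m"
  assume le: "\<And>b. b \<in> Basis \<Longrightarrow> l \<bullet> b \<le> u \<bullet> b"
  have Basis: "(\<Prod>b\<in>Basis. v \<bullet> b) = (\<Prod>i\<in>UNIV. v $ i)" for v :: "real^'k::finite"
  proof -
    have "(Basis :: (real^'k) set) = (\<lambda>i. axis i 1) ` UNIV"
      by (auto simp: Basis_vec_def)
    moreover have "inj (\<lambda>i. axis i 1 :: real^'k)" by (auto simp: inj_on_def axis_eq_axis)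
    ultimately show ?thesis by (subst \<open>Basis = _\<close>, subst prod.reindex) (simp_all add: inner_axis)
  qed
  have nth_le: "l $ i \<le> u $ i" for i
    using le[of "axis i 1"] by (simp add: inner_axis)
  have all_inv: "(\<forall>i. P (f i) i) \<longleftrightarrow> (\<forall>j. P j (inv f j))" for P
    using f by (metis bij_inv_eq_iff)
  have "reindex f -` box l u = box (reindex (inv f) l) (reindex (inv f) u :: real^'n)"
    using all_inv[of "\<lambda>j i. l $ i < x $ j \<and> x $ j < u $ i" for x]
    by (auto simp: mem_box_cart reindex_def)
  then have "emeasure (distr lborel borel (reindex f)) (box l u) =
      emeasure lborel (box (reindex (inv f) l) (reindex (inv f) u :: real^'n))"
    by (subst emeasure_distr) (auto simp: measurable_reindex)
  also have "\<dots> = ennreal (\<Prod>b\<in>Basis. (reindex (inv f) u - reindex (inv f) l :: real^'n) \<bullet> b)"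
    by (subst emeasure_lborel_box) (auto simp: Basis_vec_def inner_axis reindex_def nth_le)
  also have "(\<Prod>b\<in>Basis. (reindex (inv f) u - reindex (inv f) l :: real^'n) \<bullet> b) =
      (\<Prod>i\<in>UNIV. (u - l) $ inv f i)"
    by (simp add: Basis reindex_def)
  also have "\<dots> = (\<Prod>b\<in>Basis. (u - l) \<bullet> b)"
    unfolding Basis
    by (rule prod.reindex_bij_betw) (use f in \<open>simp add: bij_betw_inv_into\<close>)
  finally show "emeasure (distr lborel borel (reindex f)) (box l u) = (\<Prod>b\<in>Basis. (u - l) \<bullet> b)" .
qed simp

lemma nn_integral_reindex:
  assumes f: "bij (f :: 'm::finite \<Rightarrow> 'n::finite)"
    and u: "u \<in> borel_measurable borel"
  shows "(\<integral>\<^sup>+x. u x \<partial>(lborel :: (real^'m) measure)) = (\<integral>\<^sup>+x. u (reindex f x) \<partial>lborel)"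
proof -
  have "(\<integral>\<^sup>+x. u x \<partial>(lborel :: (real^'m) measure)) = (\<integral>\<^sup>+x. u x \<partial>distr lborel borel (reindex f))"
    by (simp add: distr_lborel_reindex[OF f])
  also have "\<dots> = (\<integral>\<^sup>+x. u (reindex f x) \<partial>lborel)"
    by (rule nn_integral_distr) (use u in auto)
  finally show ?thesis .
qed

text \<open>Conjugation by \<open>f\<close> is a sign-preserving bijection between the permutations of the two index
  types, which matches the two Leibniz expansions term by term.\<close>

lemma det_reindex:
  fixes A :: "real^'n::finite^'n" and f :: "'m::finite \<Rightarrow> 'n"
  assumes f: "bij f"
  shows "det (\<chi> i j. A $ f i $ f j) = det A"
proof -
  let ?\<phi> = "map_permutation UNIV f"
  have inj: "inj_on f UNIV" and img: "f ` UNIV = UNIV" using f by (auto simp: bij_def)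
  have bb: "bij_betw f UNIV UNIV" using f .
  have bij: "bij_betw ?\<phi> {p. p permutes UNIV} {p. p permutes UNIV}"
  proof (rule bij_betw_byWitness[where f' = "map_permutation UNIV (inv f)"])
    show "\<forall>p\<in>{p. p permutes UNIV}. map_permutation UNIV (inv f) (?\<phi> p) = p"
      using f by (auto intro!: map_permutation_compose_inv bb simp: bij_is_inj)
    show "\<forall>p\<in>{p. p permutes UNIV}. ?\<phi> (map_permutation UNIV (inv f) p) = p"
      using f by (auto intro!: map_permutation_compose_inv bij_imp_bij_inv simp: bij_is_surj surj_f_inv_f)
    show "?\<phi> ` {p. p permutes UNIV} \<subseteq> {p. p permutes UNIV}"
      using map_permutation_permutes[OF bb] by auto
    show "map_permutation UNIV (inv f) ` {p. p permutes UNIV} \<subseteq> {p. p permutes UNIV}"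
      using map_permutation_permutes[OF bij_imp_bij_inv[OF f]] by auto
  qed
  have "det A = (\<Sum>p\<in>{p. p permutes UNIV}. of_int (sign (?\<phi> p)) * (\<Prod>i\<in>UNIV. A $ i $ ?\<phi> p i))"
    unfolding det_def by (rule sum.reindex_bij_betw[OF bij, symmetric])
  also have "\<dots> = (\<Sum>p\<in>{p. p permutes UNIV}. of_int (sign p) * (\<Prod>i\<in>UNIV. A $ f i $ f (p i)))"
  proof (rule sum.cong[OF refl])
    fix p :: "'m \<Rightarrow> 'm" assume p: "p \<in> {p. p permutes UNIV}"
    have "(\<Prod>i\<in>UNIV. A $ i $ ?\<phi> p i) = (\<Prod>i\<in>UNIV. A $ f i $ ?\<phi> p (f i))"
      by (rule prod.reindex_bij_betw[OF bb, symmetric])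
    then show "of_int (sign (?\<phi> p)) * (\<Prod>i\<in>UNIV. A $ i $ ?\<phi> p i) =
        of_int (sign p) * (\<Prod>i\<in>UNIV. A $ f i $ f (p i))"
      using p inj by (simp add: sign_map_permutation map_permutation_apply)
  qed
  also have "\<dots> = det (\<chi> i j. A $ f i $ f j)" by (simp add: det_def)
  finally show ?thesis ..
qed

text \<open>Conjugate \<open>T\<close> with the renaming of coordinates \<open>R\<close> and apply the well-ordered case to
  \<open>R \<circ> T \<circ> R\<inverse>\<close>.\<close>

proposition nn_integral_change_of_variables:
  fixes T :: "real^'n::finite \<Rightarrow> real^'n" and h :: "real^'n \<Rightarrow> real"
  assumes S: "S \<in> sets borel" and TS: "T ` S \<in> sets borel"
    and der: "\<And>z. z \<in> S \<Longrightarrow> (T has_derivative T' z) (at z within S)"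
    and inj: "inj_on T S"
    and nonneg: "\<And>z. z \<in> T ` S \<Longrightarrow> 0 \<le> h z"
    and h: "h \<in> borel_measurable (restrict_space borel (T ` S))"
    and hT: "(\<lambda>z. \<bar>det (matrix (T' z))\<bar> * h (T z)) \<in> borel_measurable (restrict_space borel S)"
  shows "(\<integral>\<^sup>+z\<in>T ` S. ennreal (h z) \<partial>lborel) =
    (\<integral>\<^sup>+z\<in>S. ennreal (\<bar>det (matrix (T' z))\<bar> * h (T z)) \<partial>lborel)"
proof -
  let ?f = "of_ordered :: 'n ordered \<Rightarrow> 'n"
  define R where "R = (reindex ?f :: real^'n \<Rightarrow> _)"
  define R' where "R' = (reindex (inv ?f) :: _ \<Rightarrow> real^'n)"
  note bij = bij_of_ordered
  note bij' = bij_imp_bij_inv[OF bij]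
  have R'R[simp]: "R' (R x) = x" and RR'[simp]: "R (R' y) = y" for x y
    unfolding R_def R'_def by (simp_all add: reindex_inv bij)
  have mR[measurable]: "R \<in> borel_measurable borel" "R' \<in> borel_measurable borel"
    unfolding R_def R'_def by measurable
  have lin: "linear R" "linear R'" unfolding R_def R'_def by (rule linear_reindex)+
  have img: "R ` A = R' -` A" for A by (force intro: rev_image_eqI)
  have sets_R: "R ` A \<in> sets borel" if "A \<in> sets borel" for A
    unfolding img using measurable_sets[OF mR(2) that] by simp
  have restr: "v \<circ> R' \<in> borel_measurable (restrict_space borel (R ` A))"
    if "v \<in> borel_measurable (restrict_space borel A)" for v :: "_ \<Rightarrow> real" and A
    unfolding comp_def
    by (rule measurable_compose[OF measurable_restrict_space3[OF mR(2)] that]) auto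
  define U where "U = R \<circ> T \<circ> R'"
  define U' where "U' z = R \<circ> T' (R' z) \<circ> R'" for z
  have US: "U ` (R ` S) = R ` (T ` S)" by (simp add: U_def image_image)
  have det: "det (matrix (U' (R z))) = det (matrix (T' z))" for z
  proof -
    have ax: "R' (axis j 1) = axis (?f j) 1" for j
    proof -
      have "(inv ?f i = j) = (i = ?f j)" for i
        using bij_inv_eq_iff[OF bij, of j i] by auto
      then show ?thesis by (simp add: R'_def reindex_def axis_def vec_eq_iff)
    qed
    have "R y $ i = y $ ?f i" for y i by (simp add: R_def reindex_def)
    then have "matrix (U' (R z)) = (\<chi> i j. matrix (T' z) $ ?f i $ ?f j)"
      unfolding U'_def matrix_def comp_def R'R ax by simp
    then show ?thesis using det_reindex[OF bij, of "matrix (T' z)"] by simp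
  qed
  have U_at: "h (R' (U z)) = h (T (R' z))" for z by (simp add: U_def)
  have 1: "(\<integral>\<^sup>+z\<in>A. ennreal (v z) \<partial>lborel) = (\<integral>\<^sup>+z\<in>R ` A. ennreal (v (R' z)) \<partial>lborel)"
    if A: "A \<in> sets borel" and v: "v \<in> borel_measurable (restrict_space borel A)" for A and v
  proof -
    have "(\<lambda>z. ennreal (v z) * indicator A z) \<in> borel_measurable borel"
      using measurable_compose[OF v measurable_ennreal] A
      by (simp add: borel_measurable_restrict_space_iff_ennreal)
    from nn_integral_reindex[OF bij' this] show ?thesis
      unfolding R'_def[symmetric] by (simp add: img indicator_def)
  qed
  have "(\<integral>\<^sup>+z\<in>T ` S. ennreal (h z) \<partial>lborel) = (\<integral>\<^sup>+z\<in>U ` (R ` S). ennreal (h (R' z)) \<partial>lborel)"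
    unfolding US by (rule 1[OF TS h])
  also have "\<dots> = (\<integral>\<^sup>+z\<in>R ` S. ennreal (\<bar>det (matrix (U' z))\<bar> * h (R' (U z))) \<partial>lborel)"
  proof (rule nn_integral_change_of_variables_wellorder)
    show "R ` S \<in> sets borel" "U ` R ` S \<in> sets borel"
      using sets_R S TS by (auto simp: US)
    fix z assume "z \<in> R ` S"
    then obtain x where x: "x \<in> S" "z = R x" by auto
    have "(T has_derivative T' x) (at (R' z) within R' ` (R ` S))"
      using der[OF x(1)] x by (simp add: image_image)
    then have "(T \<circ> R' has_derivative T' x \<circ> R') (at z within R ` S)"
      using linear_imp_has_derivative[OF lin(2)] by (intro diff_chain_within)
    from diff_chain_within[OF this linear_imp_has_derivative[OF lin(1)]]
    show "(U has_derivative U' z) (at z within R ` S)"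
      using x by (simp add: U_def U'_def o_assoc)
  next
    show "inj_on U (R ` S)"
      using inj unfolding U_def inj_on_def by (auto dest!: arg_cong[where f=R'])
    show "0 \<le> h (R' z)" if "z \<in> U ` R ` S" for z
      using that nonneg unfolding US by auto
    show "(\<lambda>z. h (R' z)) \<in> borel_measurable (restrict_space borel (U ` R ` S))"
      using restr[OF h] by (simp add: US comp_def)
    have "(\<lambda>z. \<bar>det (matrix (U' z))\<bar> * h (R' (U z))) =
        (\<lambda>z. \<bar>det (matrix (T' z))\<bar> * h (T z)) \<circ> R'"
      using det[of "R' _"] by (auto simp: U_at)
    then show "(\<lambda>z. \<bar>det (matrix (U' z))\<bar> * h (R' (U z))) \<in> borel_measurable (restrict_space borel (R ` S))"
      using restr[OF hT] by simp
  qed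
  also have "\<dots> = (\<integral>\<^sup>+z\<in>S. ennreal (\<bar>det (matrix (T' z))\<bar> * h (T z)) \<partial>lborel)"
    unfolding 1[OF S hT]
    using det[of "R' _"] by (simp add: U_at)
  finally show ?thesis .
qed

section \<open>Charts, tangent vectors and the Gram matrix\<close>

lemma Ck_on_imp_continuous_on: "Ck_on k f S \<Longrightarrow> continuous_on S f"
  by (cases k) (auto intro!: differentiable_imp_continuous_on differentiable_at_imp_differentiable_on)

lemma Ck_riemannian_metric_0:
  "Ck_riemannian_metric k M \<A> g \<Longrightarrow> Ck_riemannian_metric 0 M \<A> g"
  unfolding Ck_riemannian_metric_def Ck_on.simps(1) by (blast intro: Ck_on_imp_continuous_on)

text \<open>Along the segment from the identity to \<open>A\<close> all matrices are positive definite, hence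
  invertible, so the determinant keeps the sign that it has at the identity.\<close>

lemma det_pos_of_positive_definite:
  fixes A :: "real^'n^'n"
  assumes pos: "\<And>u. u \<noteq> 0 \<Longrightarrow> u \<bullet> (A *v u) > 0"
  shows "det A > 0"
proof -
  \<comment> \<open>The segment from the identity to \<open>A\<close>.\<close>
  define B where "B s = (1 - s) *\<^sub>R mat 1 + s *\<^sub>R A" for s :: real
  have pos_B: "u \<bullet> (B s *v u) > 0" if "u \<noteq> 0" "0 \<le> s" "s \<le> 1" for u s
  proof -
    have "u \<bullet> (B s *v u) = (1 - s) * (u \<bullet> u) + s * (u \<bullet> (A *v u))"
      by (simp add: B_def matrix_vector_mult_add_rdistrib scaleR_matrix_vector_assoc[symmetric] inner_add_right)
    moreover have "u \<bullet> u > 0" using that by simp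
    ultimately show ?thesis using that pos[OF that(1)]
      by (cases "s = 0") (auto intro!: add_nonneg_pos)
  qed
  have det_B: "det (B s) \<noteq> 0" if "0 \<le> s" "s \<le> 1" for s
  proof -
    have "\<forall>u. B s *v u = 0 \<longrightarrow> u = 0" using pos_B[OF _ that] by force
    then show ?thesis
      by (simp add: invertible_det_nz[symmetric] invertible_left_inverse matrix_left_invertible_ker)
  qed
  have cont: "continuous_on {0..1} (\<lambda>s. det (B s))"
    unfolding B_def det_def by (intro continuous_intros)
  show ?thesis
  proof (rule ccontr)
    assume "\<not> det A > 0"
    then have "det (B 1) \<le> 0" "0 \<le> det (B 0)" by (simp_all add: B_def)
    from IVT2'[OF this _ cont] det_B show False by auto
  qed
qed

locale riemannian_manifold =
  fixes M :: "'a::t2_space set" and \<A> :: "('a, 'n::finite) chart set" and g :: "('a, 'n) metric"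
  assumes manifold: "smooth_manifold M \<A>"
    and metric: "Ck_riemannian_metric 0 M \<A> g"
begin

lemma
  assumes c: "c \<in> \<A>"
  shows openin_chart: "openin (top_of_set M) (fst c)"
    and open_chart_image: "open (snd c ` fst c)"
    and homeomorphism_chart: "homeomorphism (fst c) (snd c ` fst c) (snd c) (chart_inv c)"
  using manifold c by (auto simp: smooth_manifold_def is_chart_def)

lemma chart_subset: "c \<in> \<A> \<Longrightarrow> fst c \<subseteq> M"
  using openin_chart openin_imp_subset by blast

lemma in_chart: "x \<in> M \<Longrightarrow> \<exists>c\<in>\<A>. x \<in> fst c"
  using manifold by (auto simp: smooth_manifold_def)

lemma
  assumes c: "c \<in> \<A>"
  shows chart_inv_chart[simp]: "x \<in> fst c \<Longrightarrow> chart_inv c (snd c x) = x"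
    and chart_chart_inv[simp]: "z \<in> snd c ` fst c \<Longrightarrow> snd c (chart_inv c z) = z"
    and chart_inv_in[simp]: "z \<in> snd c ` fst c \<Longrightarrow> chart_inv c z \<in> fst c"
    and continuous_on_chart_inv: "continuous_on (snd c ` fst c) (chart_inv c)"
  using homeomorphism_chart[OF c] by (auto simp: homeomorphism_def)

lemma open_image_of_openin:
  assumes c: "c \<in> \<A>" and W: "openin (top_of_set M) W" "W \<subseteq> fst c"
  shows "open (snd c ` W)"
proof -
  have "openin (top_of_set (fst c)) W"
    using W openin_subset_trans chart_subset[OF c] by blast
  then have "openin (top_of_set (snd c ` fst c)) (snd c ` W)"
    using homeomorphism_imp_open_map[OF homeomorphism_chart[OF c]] by blast
  then show ?thesis using open_chart_image[OF c] openin_open_eq by blast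
qed

lemma openin_chart_inv_image:
  assumes c: "c \<in> \<A>" and V: "open V" "V \<subseteq> snd c ` fst c"
  shows "openin (top_of_set M) (chart_inv c ` V)"
proof -
  have "openin (top_of_set (snd c ` fst c)) V" using V by (simp add: open_subset)
  then have "openin (top_of_set (fst c)) (chart_inv c ` V)"
    using homeomorphism_imp_open_map[OF homeomorphism_chart[OF c, THEN homeomorphism_symD]] by blast
  then show ?thesis using openin_chart[OF c] openin_trans by blast
qed

lemma open_overlap:
  assumes "c \<in> \<A>" "c' \<in> \<A>"
  shows "open (snd c ` (fst c \<inter> fst c'))"
  using assms by (intro open_image_of_openin openin_Int openin_chart) auto

abbreviation jac :: "('a, 'n) chart \<Rightarrow> ('a, 'n) chart \<Rightarrow> 'a \<Rightarrow> real^'n \<Rightarrow> real^'n" where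
  "jac c c' x \<equiv> frechet_derivative (transition c c') (at (snd c x))"

lemma Ck_on_transition:
  assumes "c \<in> \<A>" "c' \<in> \<A>"
  shows "Ck_on k (transition c c') (snd c ` (fst c \<inter> fst c'))"
  using manifold assms by (auto simp: smooth_manifold_def smooth_on_def)

lemma has_derivative_transition:
  assumes "c \<in> \<A>" "c' \<in> \<A>" "x \<in> fst c" "x \<in> fst c'"
  shows "(transition c c' has_derivative jac c c' x) (at (snd c x))"
  using Ck_on_transition[OF assms(1,2), of "Suc 0"] assms
  by (auto simp: frechet_derivative_works[symmetric])

lemma linear_jac:
  assumes "c \<in> \<A>" "c' \<in> \<A>" "x \<in> fst c" "x \<in> fst c'"
  shows "linear (jac c c' x)"
  using has_derivative_linear has_derivative_transition[OF assms] by blast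

lemma continuous_on_frechet_transition:
  assumes "c \<in> \<A>" "c' \<in> \<A>"
  shows "continuous_on (snd c ` (fst c \<inter> fst c')) (\<lambda>z. frechet_derivative (transition c c') (at z) v)"
  using Ck_on_transition[OF assms, of "Suc 0"] by simp

lemma transition_chart:
  "c \<in> \<A> \<Longrightarrow> x \<in> fst c \<Longrightarrow> transition c c' (snd c x) = snd c' x"
  by (simp add: transition_def)

text \<open>The chain rule. It is what makes the coordinate representations \<open>coord_vec\<close> consistent, so that
  they are tangent vectors.\<close>

lemma jac_cocycle:
  assumes c: "c \<in> \<A>" "c' \<in> \<A>" "c'' \<in> \<A>" and x: "x \<in> fst c" "x \<in> fst c'" "x \<in> fst c''"
  shows "jac c' c'' x (jac c c' x u) = jac c c'' x u"
proof -
  let ?W = "snd c ` (fst c \<inter> fst c')"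
  have "(transition c' c'' \<circ> transition c c' has_derivative jac c' c'' x \<circ> jac c c' x) (at (snd c x))"
    using assms by (intro diff_chain_at) (auto simp: transition_chart has_derivative_transition)
  moreover have "(transition c' c'' \<circ> transition c c') z = transition c c'' z" if "z \<in> ?W" for z
    using that c by (auto simp: transition_def)
  ultimately have "(transition c c'' has_derivative jac c' c'' x \<circ> jac c c' x) (at (snd c x))"
    using has_derivative_transform_within_open[of _ _ "snd c x" UNIV ?W] open_overlap c x
    by (metis (no_types, lifting) IntI imageI)
  from has_derivative_unique[OF this has_derivative_transition] c x
  show ?thesis by (metis comp_apply)
qed

lemma jac_self:
  assumes c: "c \<in> \<A>" and x: "x \<in> fst c"
  shows "jac c c x u = u"
proof -
  have "(transition c c has_derivative (\<lambda>u. u)) (at (snd c x))"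
    by (rule has_derivative_transform_within_open[OF has_derivative_ident open_chart_image[OF c]])
      (use c x in \<open>auto simp: transition_def\<close>)
  from has_derivative_unique[OF this has_derivative_transition[OF c c x x]]
  show ?thesis by metis
qed

lemma coord_vec_in_tangent_space:
  assumes "c \<in> \<A>" "x \<in> fst c"
  shows "coord_vec \<A> c x u \<in> tangent_space \<A> x"
  using assms unfolding coord_vec_def tangent_space_def charts_at_def
  by (simp del: split_paired_All add: jac_cocycle)

lemma coord_vec_change:
  assumes "c \<in> \<A>" "c' \<in> \<A>" "x \<in> fst c" "x \<in> fst c'"
  shows "coord_vec \<A> c x u = coord_vec \<A> c' x (jac c c' x u)"
  using assms by (auto simp: coord_vec_def charts_at_def jac_cocycle)

lemma coord_vec_lincomb:
  assumes "c \<in> \<A>" "x \<in> fst c"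
  shows "coord_vec \<A> c x (r *\<^sub>R u + s *\<^sub>R v) =
    (\<lambda>c'. r *\<^sub>R coord_vec \<A> c x u c' + s *\<^sub>R coord_vec \<A> c x v c')"
  using assms by (auto simp: coord_vec_def charts_at_def linear_jac linear_add linear_scale)

lemma coord_vec_nonzero:
  assumes "c \<in> \<A>" "x \<in> fst c" "u \<noteq> 0"
  shows "coord_vec \<A> c x u \<noteq> (\<lambda>c. 0)"
proof
  assume "coord_vec \<A> c x u = (\<lambda>c. 0)"
  from fun_cong[OF this, of c] assms show False by (simp add: coord_vec_def charts_at_def jac_self)
qed

text \<open>Bilinear expansion in the coordinate basis: the Gram matrix determines the metric on all tangent
  vectors.\<close>

lemma metric_coord_vec:
  assumes c: "c \<in> \<A>" and x: "x \<in> fst c"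
  shows "g x (coord_vec \<A> c x u) (coord_vec \<A> c x w) = u \<bullet> (gram_matrix \<A> g c x *v w)"
proof -
  let ?b = "\<lambda>u w. g x (coord_vec \<A> c x u) (coord_vec \<A> c x w)"
  have ip: "inner_product_on_tangent \<A> x (g x)"
    using metric chart_subset[OF c] x by (auto simp: Ck_riemannian_metric_def)
  have sym: "?b u w = ?b w u" for u w
    using ip coord_vec_in_tangent_space[OF c x] by (auto simp: inner_product_on_tangent_def)
  have comb: "?b (r *\<^sub>R u + s *\<^sub>R v) w = r * ?b u w + s * ?b v w" for r s u v w
    using ip coord_vec_in_tangent_space[OF c x]
    by (auto simp: inner_product_on_tangent_def coord_vec_lincomb[OF c x])
  have lin1: "linear (\<lambda>u. ?b u w)" for w
    using comb[of 1 _ 1 _ w] comb[of _ _ 0 0 w] by (intro linearI) auto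
  have lin2: "linear (\<lambda>w. ?b u w)" for u
    using lin1[of u] sym by simp
  have "?b u w = (\<Sum>i\<in>UNIV. u $ i * ?b (axis i 1) w)"
    using linear_sum[OF lin1, of "\<lambda>i. u $ i *\<^sub>R axis i 1" UNIV w] linear_scale[OF lin1, of _ _ w]
    by (simp add: basis_expansion[of u, unfolded scalar_mult_eq_scaleR])
  also have "\<dots> = (\<Sum>i\<in>UNIV. u $ i * (\<Sum>j\<in>UNIV. w $ j * ?b (axis i 1) (axis j 1)))"
  proof (rule sum.cong[OF refl])
    fix i
    show "u $ i * ?b (axis i 1) w = u $ i * (\<Sum>j\<in>UNIV. w $ j * ?b (axis i 1) (axis j 1))"
      using linear_sum[OF lin2, of "axis i 1" "\<lambda>j. w $ j *\<^sub>R axis j 1" UNIV] linear_scale[OF lin2, of "axis i 1"]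
      by (simp add: basis_expansion[of w, unfolded scalar_mult_eq_scaleR])
  qed
  also have "\<dots> = u \<bullet> (gram_matrix \<A> g c x *v w)"
    by (simp add: inner_vec_def matrix_vector_mult_def gram_matrix_def mult.commute)
  finally show ?thesis .
qed

lemma gram_matrix_positive_definite:
  assumes c: "c \<in> \<A>" and x: "x \<in> fst c" and u: "u \<noteq> 0"
  shows "u \<bullet> (gram_matrix \<A> g c x *v u) > 0"
proof -
  have "inner_product_on_tangent \<A> x (g x)"
    using metric chart_subset[OF c] x by (auto simp: Ck_riemannian_metric_def)
  then show ?thesis
    unfolding metric_coord_vec[OF c x, symmetric]
    using coord_vec_in_tangent_space[OF c x] coord_vec_nonzero[OF c x u]
    by (auto simp: inner_product_on_tangent_def)
qed

lemma det_gram_pos: "c \<in> \<A> \<Longrightarrow> x \<in> fst c \<Longrightarrow> det (gram_matrix \<A> g c x) > 0"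
  by (intro det_pos_of_positive_definite gram_matrix_positive_definite)

text \<open>A tangent vector represented by \<open>u\<close> in \<open>c\<close> is represented by \<open>J u\<close> in \<open>c'\<close>, so both matrices
  represent the same bilinear form.\<close>

lemma gram_matrix_change:
  assumes c: "c \<in> \<A>" "c' \<in> \<A>" and x: "x \<in> fst c" "x \<in> fst c'"
  shows "gram_matrix \<A> g c x =
    transpose (matrix (jac c c' x)) ** gram_matrix \<A> g c' x ** matrix (jac c c' x)"
proof -
  let ?J = "matrix (jac c c' x)"
  have J: "?J *v u = jac c c' x u" for u
    using linear_jac[OF c x] by (simp add: matrix_works)
  have "u \<bullet> (gram_matrix \<A> g c x *v w) =
      u \<bullet> ((transpose ?J ** gram_matrix \<A> g c' x ** ?J) *v w)" for u w
  proof -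
    have "u \<bullet> (gram_matrix \<A> g c x *v w) = (?J *v u) \<bullet> (gram_matrix \<A> g c' x *v (?J *v w))"
      unfolding metric_coord_vec[OF c(1) x(1), symmetric]
      by (simp add: coord_vec_change[OF c x] metric_coord_vec[OF c(2) x(2)] J)
    also have "\<dots> = u \<bullet> (transpose ?J *v (gram_matrix \<A> g c' x *v (?J *v w)))"
      unfolding transpose_matrix_vector
      using dot_lmul_matrix[of "gram_matrix \<A> g c' x *v (?J *v w)" ?J u] by (simp add: inner_commute)
    finally show ?thesis by (simp add: matrix_vector_mul_assoc matrix_mul_assoc)
  qed
  then have "\<forall>w. gram_matrix \<A> g c x *v w = (transpose ?J ** gram_matrix \<A> g c' x ** ?J) *v w"
    by (subst vector_eq_ldot[symmetric]) simp
  then show ?thesis unfolding matrix_eq .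
qed

definition vol_density :: "('a, 'n) chart \<Rightarrow> real^'n \<Rightarrow> real" where
  "vol_density c z = sqrt (det (gram_matrix \<A> g c (chart_inv c z)))"

lemma vol_density_pos: "c \<in> \<A> \<Longrightarrow> z \<in> snd c ` fst c \<Longrightarrow> vol_density c z > 0"
  by (simp add: vol_density_def det_gram_pos)

text \<open>Take determinants in \<open>gram_matrix_change\<close>.\<close>

lemma vol_density_change:
  assumes c: "c \<in> \<A>" "c' \<in> \<A>" and z: "z \<in> snd c ` (fst c \<inter> fst c')"
  shows "vol_density c z =
    \<bar>det (matrix (frechet_derivative (transition c c') (at z)))\<bar> * vol_density c' (transition c c' z)"
proof -
  obtain x where x: "x \<in> fst c" "x \<in> fst c'" "z = snd c x" using z by auto
  have "det (gram_matrix \<A> g c x) = (det (matrix (jac c c' x)))\<^sup>2 * det (gram_matrix \<A> g c' x)"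
    by (simp add: gram_matrix_change[OF c x(1,2)] det_mul power2_eq_square)
  then show ?thesis
    using c x by (simp add: vol_density_def transition_chart real_sqrt_mult)
qed

lemma continuous_on_gram:
  assumes c: "c \<in> \<A>"
  shows "continuous_on (snd c ` fst c) (\<lambda>z. gram_matrix \<A> g c (chart_inv c z) $ i $ j)"
  using metric c by (simp add: Ck_riemannian_metric_def)

lemma continuous_on_vol_density:
  assumes c: "c \<in> \<A>"
  shows "continuous_on (snd c ` fst c) (vol_density c)"
  unfolding vol_density_def[abs_def] det_def by (intro continuous_intros continuous_on_gram c)

end

section \<open>Existence and uniqueness of the Riemannian volume\<close>

context riemannian_manifold
begin

abbreviation borel_M :: "'a measure" where
  "borel_M \<equiv> restrict_space borel M"

lemma sets_borel_M_openin: "openin (top_of_set M) W \<Longrightarrow> W \<in> sets borel_M"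
  by (auto simp: openin_open sets_restrict_space)

lemma fst_chart_sets: "c \<in> \<A> \<Longrightarrow> fst c \<in> sets borel_M"
  by (intro sets_borel_M_openin openin_chart)

lemma measurable_chart_inv:
  assumes c: "c \<in> \<A>"
  shows "chart_inv c \<in> measurable (restrict_space borel (snd c ` fst c)) borel_M"
proof (rule measurable_restrict_space2)
  show "chart_inv c \<in> space (restrict_space borel (snd c ` fst c)) \<rightarrow> M"
    using c chart_subset[OF c] by (auto simp: space_restrict_space)
  show "chart_inv c \<in> borel_measurable (restrict_space borel (snd c ` fst c))"
    by (intro borel_measurable_continuous_on_restrict continuous_on_chart_inv c)
qed

lemma inj_on_chart: "c \<in> \<A> \<Longrightarrow> inj_on (snd c) (fst c)"
  by (rule inj_on_inverseI[of _ "chart_inv c"]) simp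

lemma chart_image_eq:
  assumes c: "c \<in> \<A>" and A: "A \<subseteq> fst c"
  shows "snd c ` A = chart_inv c -` A \<inter> snd c ` fst c"
  using assms by force

lemma chart_image_borel:
  assumes c: "c \<in> \<A>" and A: "A \<in> sets borel_M" "A \<subseteq> fst c"
  shows "snd c ` A \<in> sets borel"
proof -
  have "chart_inv c -` A \<inter> space (restrict_space borel (snd c ` fst c))
      \<in> sets (restrict_space borel (snd c ` fst c))"
    by (rule measurable_sets[OF measurable_chart_inv[OF c] A(1)])
  then show ?thesis
    using open_chart_image[OF c]
    by (simp add: chart_image_eq[OF c A(2)] space_restrict_space sets_restrict_space_iff)
qed

text \<open>The image on \<open>M\<close> of the weighted Lebesgue measure of the chart domain. Its values on sets that
  leave the domain of \<open>c\<close> are those of the part inside.\<close>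

definition chart_measure :: "('a, 'n) chart \<Rightarrow> 'a measure" where
  "chart_measure c =
    distr (density (restrict_space lborel (snd c ` fst c)) (\<lambda>z. ennreal (vol_density c z)))
      borel_M (chart_inv c)"

lemma sets_chart_measure[simp]: "sets (chart_measure c) = sets borel_M"
  by (simp add: chart_measure_def)

lemma emeasure_chart_measure:
  assumes c: "c \<in> \<A>" and A: "A \<in> sets borel_M" "A \<subseteq> fst c"
  shows "emeasure (chart_measure c) A = (\<integral>\<^sup>+z\<in>snd c ` A. ennreal (vol_density c z) \<partial>lborel)"
proof -
  let ?O = "snd c ` fst c" and ?B = "snd c ` A"
  have O: "?O \<in> sets borel" and B: "?B \<in> sets borel"
    using open_chart_image[OF c] chart_image_borel[OF c A] by auto
  have sets: "sets (restrict_space lborel ?O) = sets (restrict_space borel ?O)"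
    by (simp add: sets_restrict_space)
  have dens: "(\<lambda>z. ennreal (vol_density c z)) \<in> borel_measurable (restrict_space lborel ?O)"
    using borel_measurable_continuous_on_restrict[OF continuous_on_vol_density[OF c]]
    by (simp add: measurable_cong_sets[OF sets refl])
  have inv: "chart_inv c \<in> measurable (restrict_space lborel ?O) borel_M"
    using measurable_chart_inv[OF c] by (simp add: measurable_cong_sets[OF sets refl])
  have B_sub: "?B \<subseteq> ?O" using A by auto
  have "emeasure (chart_measure c) A =
      emeasure (density (restrict_space lborel ?O) (\<lambda>z. ennreal (vol_density c z))) ?B"
    unfolding chart_measure_def
    using inv A by (subst emeasure_distr) (auto simp: space_restrict_space chart_image_eq[OF c A(2)])
  also have "\<dots> = (\<integral>\<^sup>+z\<in>?B. ennreal (vol_density c z) \<partial>restrict_space lborel ?O)"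
    using B B_sub O by (intro emeasure_density dens) (auto simp: sets_restrict_space_iff)
  also have "\<dots> = (\<integral>\<^sup>+z. ennreal (vol_density c z) * indicator ?B z * indicator ?O z \<partial>lborel)"
    using O by (subst nn_integral_restrict_space) auto
  also have "\<dots> = (\<integral>\<^sup>+z\<in>?B. ennreal (vol_density c z) \<partial>lborel)"
    using B_sub by (intro nn_integral_cong) (auto simp: indicator_def)
  finally show ?thesis .
qed

text \<open>By \<open>vol_density_change\<close> the factor \<open>\<bar>det J\<bar>\<close> produced by the change of variables is exactly
  the quotient of the two densities.\<close>

lemma chart_measure_compatible:
  assumes c: "c \<in> \<A>" "c' \<in> \<A>" and A: "A \<in> sets borel_M" "A \<subseteq> fst c" "A \<subseteq> fst c'"
  shows "emeasure (chart_measure c) A = emeasure (chart_measure c') A"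
proof -
  let ?T = "transition c c'" and ?S = "snd c ` A"
  let ?T' = "\<lambda>z. frechet_derivative ?T (at z)"
  have TS: "?T ` ?S = snd c' ` A"
    unfolding image_image by (rule image_cong) (use A c in \<open>auto simp: transition_chart\<close>)
  have change: "\<bar>det (matrix (?T' z))\<bar> * vol_density c' (?T z) = vol_density c z" if "z \<in> ?S" for z
  proof -
    have "z \<in> snd c ` (fst c \<inter> fst c')" using that A by auto
    then show ?thesis by (rule vol_density_change[OF c, symmetric])
  qed
  have "(\<integral>\<^sup>+z\<in>?T ` ?S. ennreal (vol_density c' z) \<partial>lborel) =
      (\<integral>\<^sup>+z\<in>?S. ennreal (\<bar>det (matrix (?T' z))\<bar> * vol_density c' (?T z)) \<partial>lborel)"
  proof (rule nn_integral_change_of_variables)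
    show "?S \<in> sets borel" "?T ` ?S \<in> sets borel"
      unfolding TS using chart_image_borel c A by auto
    fix z assume "z \<in> ?S"
    then obtain x where "x \<in> A" "z = snd c x" by auto
    then have "(?T has_derivative ?T' z) (at z)"
      using has_derivative_transition[OF c, of x] A by auto
    then show "(?T has_derivative ?T' z) (at z within ?S)"
      by (rule has_derivative_at_withinI)
  next
    show "inj_on ?T ?S"
    proof (rule inj_onI)
      fix z w assume "z \<in> ?S" "w \<in> ?S" "?T z = ?T w"
      then obtain x y where xy: "x \<in> A" "y \<in> A" "z = snd c x" "w = snd c y" "?T z = ?T w" by blast
      then have xy': "x \<in> fst c" "x \<in> fst c'" "y \<in> fst c" "y \<in> fst c'" using A by auto
      then have "snd c' x = snd c' y" using xy c(1) by (simp add: transition_chart)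
      then have "x = y" using inj_on_chart[OF c(2)] xy' by (meson inj_onD)
      then show "z = w" using xy by simp
    qed
    show "0 \<le> vol_density c' z" if "z \<in> ?T ` ?S" for z
      using vol_density_pos[OF c(2), of z] that A unfolding TS by force
    show "vol_density c' \<in> borel_measurable (restrict_space borel (?T ` ?S))"
      unfolding TS
      by (intro borel_measurable_continuous_on_restrict continuous_on_subset[OF continuous_on_vol_density[OF c(2)]])
        (use A in auto)
    have "continuous_on ?S (\<lambda>z. \<bar>det (matrix (?T' z))\<bar> * vol_density c' (?T z))"
      using continuous_on_subset[OF continuous_on_vol_density[OF c(1)], of ?S] A
      by (subst continuous_on_cong[OF refl change]) auto
    then show "(\<lambda>z. \<bar>det (matrix (?T' z))\<bar> * vol_density c' (?T z)) \<in> borel_measurable (restrict_space borel ?S)"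
      by (rule borel_measurable_continuous_on_restrict)
  qed
  also have "\<dots> = (\<integral>\<^sup>+z\<in>?S. ennreal (vol_density c z) \<partial>lborel)"
    by (rule nn_integral_cong) (auto simp: change indicator_def)
  finally show ?thesis
    using c A by (simp add: emeasure_chart_measure TS)
qed

end

locale compact_riemannian_manifold = riemannian_manifold +
  assumes compact_M: "compact M"
begin

lemma finite_chart_cover:
  "\<exists>(k::nat) c. (\<forall>i<k. c i \<in> \<A>) \<and> M = (\<Union>i<k. fst (c i))"
proof -
  have "\<exists>\<D>\<subseteq>fst ` \<A>. finite \<D> \<and> M \<subseteq> \<Union>\<D>"
  proof (rule compact_M[unfolded compact_eq_openin_cover, rule_format], intro conjI ballI)
    show "openin (top_of_set M) U" if "U \<in> fst ` \<A>" for U using that openin_chart by blast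
    show "M \<subseteq> \<Union>(fst ` \<A>)" using in_chart by blast
  qed
  then obtain \<D> where \<D>: "\<D> \<subseteq> fst ` \<A>" "finite \<D>" "M \<subseteq> \<Union>\<D>" by blast
  from finite_subset_image[OF \<D>(2,1)] obtain \<C>
    where \<C>: "\<C> \<subseteq> \<A>" "finite \<C>" "\<D> = fst ` \<C>" by blast
  obtain c and k :: nat where "\<C> = c ` {i. i < k}"
    using finite_imp_nat_seg_image_inj_on[OF \<C>(2)] by blast
  then have "c i \<in> \<A>" if "i < k" for i using \<C>(1) that by blast
  moreover have "M = (\<Union>i<k. fst (c i))"
  proof
    show "M \<subseteq> (\<Union>i<k. fst (c i))" using \<D>(3) \<C>(3) \<open>\<C> = c ` {i. i < k}\<close> by auto
    show "(\<Union>i<k. fst (c i)) \<subseteq> M" using chart_subset calculation by blast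
  qed
  ultimately show ?thesis by blast
qed

text \<open>Disjointing a finite chart cover gives a Borel partition \<open>E\<close> of \<open>M\<close> with every piece inside one
  chart. A measure on \<open>M\<close> is the sum of its restrictions to the pieces, and these are prescribed by the
  charts; this yields uniqueness, and it is also the definition for existence, where
  compatibility of the chart measures gives the right value in every other chart.\<close>

lemma ex1_riemannian_volume: "\<exists>!\<mu>. is_riemannian_volume M \<A> g \<mu>"
proof -
  obtain k :: nat and c where c: "\<And>i. i < k \<Longrightarrow> c i \<in> \<A>" and M: "M = (\<Union>i<k. fst (c i))"
    using finite_chart_cover by blast
  define E where "E = disjointed (\<lambda>i. fst (c i))"
  have disj: "disjoint_family_on E {..<k}"
    unfolding E_def by (rule disjoint_family_on_mono[OF subset_UNIV disjoint_family_disjointed])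
  have E_sub: "E i \<subseteq> fst (c i)" for i
    unfolding E_def by (rule disjointed_subset)
  have E_sets: "E i \<in> sets borel_M" if "i < k" for i
    unfolding E_def disjointed_def using that
    by (intro sets.Diff sets.finite_UN fst_chart_sets c) auto
  have E_cover: "A = (\<Union>i<k. A \<inter> E i)" if "A \<subseteq> M" for A
  proof -
    have "(\<Union>i<k. E i) = M"
      using finite_UN_disjointed_eq[of "\<lambda>i. fst (c i)" k] M unfolding E_def by (simp add: lessThan_atLeast0)
    then show ?thesis using that by auto
  qed
  have sum_E: "(\<Sum>i<k. emeasure \<nu> (A \<inter> E i)) = emeasure \<nu> A"
    if "sets \<nu> = sets borel_M" "A \<in> sets borel_M" for \<nu> :: "'a measure" and A
  proof -
    have "(\<Sum>i<k. emeasure \<nu> (A \<inter> E i)) = emeasure \<nu> (\<Union>i<k. A \<inter> E i)"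
    proof (rule sum_emeasure)
      show "disjoint_family_on (\<lambda>i. A \<inter> E i) {..<k}"
        using disj by (rule disjoint_family_on_bisimulation) auto
    qed (use that E_sets in auto)
    also have "(\<Union>i<k. A \<inter> E i) = A"
      using E_cover[of A] sets.sets_into_space[OF that(2)] by (simp add: space_restrict_space)
    finally show ?thesis .
  qed
  define m where "m A = (\<Sum>i<k. emeasure (chart_measure (c i)) (A \<inter> E i))" for A
  define \<mu> where "\<mu> = measure_of M (sets borel_M) m"
  have sp: "space borel_M = M" by (simp add: space_restrict_space)
  have sets_\<mu>: "sets \<mu> = sets borel_M"
    unfolding \<mu>_def using sets.sigma_sets_eq[of borel_M] sets.space_closed[of borel_M]
    by (simp add: sets_measure_of sp)
  have em_\<mu>: "emeasure \<mu> A = m A" if A: "A \<in> sets borel_M" for A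
    unfolding \<mu>_def
  proof (rule emeasure_measure_of_sigma)
    show "sigma_algebra M (sets borel_M)"
      using sets.sigma_algebra_axioms[of borel_M] by (simp add: sp)
    show "positive (sets borel_M) m" by (simp add: positive_def m_def)
    show "countably_additive (sets borel_M) m"
    proof (rule countably_additiveI)
      fix A :: "nat \<Rightarrow> 'a set"
      assume A: "range A \<subseteq> sets borel_M" "disjoint_family A" "\<Union>(range A) \<in> sets borel_M"
      have "(\<Sum>n. m (A n)) = (\<Sum>i<k. \<Sum>n. emeasure (chart_measure (c i)) (A n \<inter> E i))"
        unfolding m_def by (rule suminf_sum) simp
      also have "\<dots> = (\<Sum>i<k. emeasure (chart_measure (c i)) (\<Union>n. A n \<inter> E i))"
        using A E_sets
        by (intro sum.cong refl suminf_emeasure) (auto simp: disjoint_family_on_def)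
      also have "\<dots> = m (\<Union>(range A))"
        unfolding m_def by (intro sum.cong refl arg_cong2[where f=emeasure]) auto
      finally show "(\<Sum>n. m (A n)) = m (\<Union>(range A))" .
    qed
  qed (rule A)
  have "is_riemannian_volume M \<A> g \<mu>"
    unfolding is_riemannian_volume_def
  proof (intro conjI ballI impI sets_\<mu>)
    fix c' A assume c': "c' \<in> \<A>" and "A \<in> sets \<mu>" and sub: "A \<subseteq> fst c'"
    then have A: "A \<in> sets borel_M" by (simp add: sets_\<mu>)
    have "emeasure \<mu> A = (\<Sum>i<k. emeasure (chart_measure c') (A \<inter> E i))"
      unfolding em_\<mu>[OF A] m_def
      using c c' A E_sets E_sub sub
      by (intro sum.cong refl chart_measure_compatible) auto
    also have "\<dots> = emeasure (chart_measure c') A"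
      by (rule sum_E) (simp_all add: A)
    finally show "emeasure \<mu> A =
      (\<integral>\<^sup>+z\<in>snd c' ` A. ennreal (sqrt (det (gram_matrix \<A> g c' (chart_inv c' z)))) \<partial>lborel)"
      by (simp add: emeasure_chart_measure c' A sub vol_density_def)
  qed
  moreover have "\<mu>1 = \<mu>2"
    if 1: "is_riemannian_volume M \<A> g \<mu>1" and 2: "is_riemannian_volume M \<A> g \<mu>2" for \<mu>1 \<mu>2
  proof (rule measure_eqI)
    have s: "sets \<mu>1 = sets borel_M" "sets \<mu>2 = sets borel_M"
      using 1 2 by (auto simp: is_riemannian_volume_def)
    then show "sets \<mu>1 = sets \<mu>2" by simp
    fix A assume "A \<in> sets \<mu>1"
    then have A: "A \<in> sets borel_M" using s by simp
    have "emeasure \<mu>1 (A \<inter> E i) = emeasure \<mu>2 (A \<inter> E i)" if "i < k" for i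
      using 1 2 c[OF that] E_sets[OF that] E_sub[of i] A
      by (auto simp: is_riemannian_volume_def le_infI2)
    then show "emeasure \<mu>1 A = emeasure \<mu>2 A"
      using sum_E[OF s(1) A] sum_E[OF s(2) A] by (metis (no_types, lifting) lessThan_iff sum.cong)
  qed
  ultimately show ?thesis by blast
qed

abbreviation vol :: "'a measure" where
  "vol \<equiv> riemannian_volume M \<A> g"

lemma is_riemannian_volume_vol: "is_riemannian_volume M \<A> g vol"
  unfolding riemannian_volume_def by (rule theI'[OF ex1_riemannian_volume])

lemma sets_vol: "sets vol = sets borel_M"
  using is_riemannian_volume_vol by (simp add: is_riemannian_volume_def)

lemma space_vol: "space vol = M"
  using sets_eq_imp_space_eq[OF sets_vol] by (simp add: space_restrict_space)

lemma emeasure_vol_chart: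
  assumes "c \<in> \<A>" "A \<in> sets borel_M" "A \<subseteq> fst c"
  shows "emeasure vol A = (\<integral>\<^sup>+z\<in>snd c ` A. ennreal (vol_density c z) \<partial>lborel)"
  using is_riemannian_volume_vol assms
  by (simp add: is_riemannian_volume_def sets_vol vol_density_def)

text \<open>The density is positive, so a null open set inside a chart would have a negligible open image in
  \<open>real ^ 'n\<close>.\<close>

lemma emeasure_vol_open_pos:
  assumes W: "openin (top_of_set M) W" "W \<noteq> {}"
  shows "emeasure vol W > 0"
proof -
  obtain x where x: "x \<in> W" using W by auto
  then obtain c where c: "c \<in> \<A>" "x \<in> fst c"
    using in_chart openin_imp_subset[OF W(1)] by blast
  let ?V = "W \<inter> fst c"
  let ?O = "snd c ` ?V"
  have V: "openin (top_of_set M) ?V" using W openin_chart[OF c(1)] by blast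
  have VW: "W \<in> sets borel_M" "?V \<in> sets borel_M"
    using W V sets_borel_M_openin by auto
  have O: "open ?O" using V c by (intro open_image_of_openin) auto
  have meas: "(\<lambda>z. ennreal (vol_density c z) * indicator ?O z) \<in> borel_measurable lborel"
  proof -
    have "vol_density c \<in> borel_measurable (restrict_space borel ?O)"
      by (intro borel_measurable_continuous_on_restrict continuous_on_subset[OF continuous_on_vol_density[OF c(1)]]) auto
    then have "(\<lambda>z. ennreal (vol_density c z)) \<in> borel_measurable (restrict_space borel ?O)"
      by simp
    then show ?thesis using O by (simp add: borel_measurable_restrict_space_iff_ennreal)
  qed
  have "emeasure vol ?V \<noteq> 0"
  proof
    assume "emeasure vol ?V = 0"
    then have "AE z in lborel. ennreal (vol_density c z) * indicator ?O z = 0"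
      using meas V VW c by (simp add: emeasure_vol_chart nn_integral_0_iff_AE)
    then have "AE z in lborel. z \<notin> ?O"
    proof (rule AE_mp, intro AE_I2 impI notI)
      fix z assume z: "ennreal (vol_density c z) * indicator ?O z = 0" "z \<in> ?O"
      then have "vol_density c z > 0" by (intro vol_density_pos c) auto
      with z show False by simp
    qed
    then have "?O \<in> null_sets lborel" using O by (simp add: AE_iff_null_sets)
    then have "negligible ?O"
      using negligible_iff_null_sets null_sets_completionI by blast
    then show False using open_not_negligible[OF O] c x by auto
  qed
  moreover have "emeasure vol ?V \<le> emeasure vol W"
    using VW by (intro emeasure_mono) (auto simp: sets_vol)
  ultimately show ?thesis by (metis not_gr_zero le_zero_eq)
qed

text \<open>The density is bounded on a closed coordinate ball.\<close>

lemma locally_finite_vol: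
  assumes x: "x \<in> M"
  obtains W where "openin (top_of_set M) W" "x \<in> W" "emeasure vol W < \<infinity>"
proof -
  obtain c where c: "c \<in> \<A>" "x \<in> fst c" using in_chart x by blast
  obtain r where r: "r > 0" "cball (snd c x) r \<subseteq> snd c ` fst c"
    using open_chart_image[OF c(1)] c(2) open_contains_cball by blast
  have "compact (vol_density c ` cball (snd c x) r)"
    using continuous_on_subset[OF continuous_on_vol_density[OF c(1)] r(2)]
    by (intro compact_continuous_image) auto
  then obtain B where B: "\<And>z. z \<in> cball (snd c x) r \<Longrightarrow> \<bar>vol_density c z\<bar> \<le> B"
    by (metis compact_imp_bounded bounded_iff imageI real_norm_def)
  let ?W = "chart_inv c ` ball (snd c x) r"
  have ball: "ball (snd c x) r \<subseteq> snd c ` fst c" using r(2) ball_subset_cball by blast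
  have W: "openin (top_of_set M) ?W"
    using ball by (intro openin_chart_inv_image c) auto
  have img: "snd c ` ?W = ball (snd c x) r"
    using ball c(1) by (force simp: image_image)
  have sub: "?W \<subseteq> fst c" using ball c(1) by force
  have "emeasure vol ?W = (\<integral>\<^sup>+z\<in>ball (snd c x) r. ennreal (vol_density c z) \<partial>lborel)"
    using W c sub by (simp add: emeasure_vol_chart sets_borel_M_openin img)
  also have "\<dots> \<le> (\<integral>\<^sup>+z. ennreal B * indicator (ball (snd c x) r) z \<partial>lborel)"
  proof (rule nn_integral_mono)
    fix z
    show "ennreal (vol_density c z) * indicator (ball (snd c x) r) z
        \<le> ennreal B * indicator (ball (snd c x) r) z"
      using B[of z] by (cases "z \<in> ball (snd c x) r") (auto intro!: ennreal_leI)
  qed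
  also have "\<dots> < \<infinity>"
    using emeasure_lborel_ball_finite[of "snd c x" r]
    by (simp add: nn_integral_cmult_indicator ennreal_mult_less_top)
  finally have "emeasure vol ?W < \<infinity>" .
  moreover have "x \<in> ?W" using c r by (intro image_eqI[of _ _ "snd c x"]) auto
  ultimately show ?thesis using W that by blast
qed

end

section \<open>Upper semicontinuity of the geodesic distance\<close>

text \<open>Subadditivity over a measurable set and its complement holds for functions that need not be
  measurable, because it holds for the simple functions below them. This serves to split the
  length of a concatenated curve.\<close>

lemma nn_integral_le_split:
  assumes A: "A \<in> sets N"
  shows "(\<integral>\<^sup>+x. f x \<partial>N) \<le> (\<integral>\<^sup>+x. f x * indicator A x \<partial>N) + (\<integral>\<^sup>+x. f x * indicator (- A) x \<partial>N)"
  unfolding nn_integral_def[of N f]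
proof (rule SUP_least, safe)
  fix s assume s: "simple_function N s" "s \<le> f"
  have [measurable]: "s \<in> borel_measurable N" "A \<in> sets N"
    using s A borel_measurable_simple_function by auto
  have "integral\<^sup>S N s = (\<integral>\<^sup>+x. s x \<partial>N)" by (simp add: nn_integral_eq_simple_integral s)
  also have "\<dots> = (\<integral>\<^sup>+x. s x * indicator A x + s x * indicator (space N - A) x \<partial>N)"
    by (rule nn_integral_cong) (auto simp: indicator_def)
  also have "\<dots> = (\<integral>\<^sup>+x. s x * indicator A x \<partial>N) + (\<integral>\<^sup>+x. s x * indicator (space N - A) x \<partial>N)"
    by (rule nn_integral_add) auto
  also have "\<dots> \<le> (\<integral>\<^sup>+x. f x * indicator A x \<partial>N) + (\<integral>\<^sup>+x. f x * indicator (- A) x \<partial>N)"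
    using s(2) by (intro add_mono nn_integral_mono mult_mono) (auto simp: le_fun_def indicator_def)
  finally show "integral\<^sup>S N s \<le> \<dots>" .
qed

lemma C1_curveD:
  assumes "C1_curve M \<A> a b \<gamma>"
  shows "continuous_on {a..b} \<gamma>" "\<gamma> ` {a..b} \<subseteq> M"
  using assms unfolding C1_curve_def by (simp_all only:)

lemma C1_curve_cong:
  assumes C: "C1_curve M \<A> a b \<gamma>" and eq: "\<And>s. s \<in> {a..b} \<Longrightarrow> \<gamma>' s = \<gamma> s"
  shows "C1_curve M \<A> a b \<gamma>'"
  unfolding C1_curve_def
proof (intro conjI ballI)
  show "continuous_on {a..b} \<gamma>'"
    using continuous_on_eq[OF C1_curveD(1)[OF C]] eq by simp
  show "\<gamma>' ` {a..b} \<subseteq> M" using C1_curveD(2)[OF C] eq by auto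
  fix c assume "c \<in> \<A>"
  then obtain D where D: "continuous_on {s\<in>{a..b}. \<gamma> s \<in> fst c} D"
    "\<And>s. s \<in> {a..b} \<Longrightarrow> \<gamma> s \<in> fst c \<Longrightarrow> (snd c \<circ> \<gamma> has_vector_derivative D s) (at s within {a..b})"
    using C unfolding C1_curve_def by blast
  have "{s\<in>{a..b}. \<gamma>' s \<in> fst c} = {s\<in>{a..b}. \<gamma> s \<in> fst c}" using eq by auto
  moreover have "(snd c \<circ> \<gamma>' has_vector_derivative D s) (at s within {a..b})"
    if "s \<in> {a..b}" "\<gamma>' s \<in> fst c" for s
  proof (rule has_vector_derivative_transform[OF that(1)])
    show "(snd c \<circ> \<gamma> has_vector_derivative D s) (at s within {a..b})"
      using D(2) that eq by simp
    show "(snd c \<circ> \<gamma>') u = (snd c \<circ> \<gamma>) u" if "u \<in> {a..b}" for u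
      using eq[OF that] by simp
  qed
  ultimately show "\<exists>D. continuous_on {s\<in>{a..b}. \<gamma>' s \<in> fst c} D \<and>
      (\<forall>s\<in>{a..b}. \<gamma>' s \<in> fst c \<longrightarrow> (snd c \<circ> \<gamma>' has_vector_derivative D s) (at s within {a..b}))"
    using D(1) by (intro exI[of _ D]) simp
qed

lemma piecewise_C1_curveD:
  assumes "piecewise_C1_curve M \<A> a b \<gamma>"
  shows "continuous_on {a..b} \<gamma>" "\<gamma> ` {a..b} \<subseteq> M"
  using assms unfolding piecewise_C1_curve_def by (simp_all only:)

lemma velocity_cong:
  fixes \<A> :: "('a, 'n::finite) chart set"
  assumes "open I" "s \<in> I" "\<And>u. u \<in> I \<Longrightarrow> \<gamma>' u = \<gamma> u"
  shows "velocity \<A> \<gamma>' s = velocity \<A> \<gamma> s"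
proof -
  have "vector_derivative (snd c \<circ> \<gamma>') (at s) = vector_derivative (snd c \<circ> \<gamma>) (at s)"
    for c :: "('a, 'n) chart"
    using assms by (intro vector_derivative_cong_eq) (auto simp: eventually_nhds)
  then show ?thesis using assms by (auto simp: velocity_def fun_eq_iff)
qed

text \<open>Witnessed by the constant curve on the degenerate interval \<open>{0..0}\<close>, which is a null set.\<close>

lemma geodesic_dist_self:
  assumes x: "x \<in> M"
  shows "geodesic_dist M \<A> g x x = 0"
proof -
  have "piecewise_C1_curve M \<A> 0 0 (\<lambda>_. x)"
    unfolding piecewise_C1_curve_def
  proof (rule conjI[OF continuous_on_const], rule conjI)
    show "(\<lambda>_. x) ` {0..0} \<subseteq> M" using x by blast
    show "\<exists>F. finite F \<and> (\<forall>s s'. 0 \<le> s \<and> s < s' \<and> s' \<le> 0 \<and> {s<..<s'} \<inter> F = {} \<longrightarrow>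
        C1_curve M \<A> s s' (\<lambda>_. x))"
      by (rule exI[of _ "{}"], rule conjI[OF finite.emptyI]) force
  qed
  then have "\<exists>a b \<gamma>. curve_length \<A> g 0 0 (\<lambda>_. x) = curve_length \<A> g a b \<gamma> \<and>
      a \<le> b \<and> piecewise_C1_curve M \<A> a b \<gamma> \<and> \<gamma> a = x \<and> \<gamma> b = x"
    by (intro exI[of _ "0::real"] exI[of _ "\<lambda>_. x"] conjI) (rule refl order_refl | assumption)+
  then have "geodesic_dist M \<A> g x x \<le> curve_length \<A> g 0 0 (\<lambda>_. x)"
    unfolding geodesic_dist_def by (intro Inf_lower CollectI)
  also have "\<dots> = (\<integral>\<^sup>+s. 0 \<partial>(lborel :: real measure))"
    unfolding curve_length_def
  proof (rule nn_integral_cong_AE)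
    show "AE s in lborel. ennreal (sqrt (g x (velocity \<A> (\<lambda>_. x) s) (velocity \<A> (\<lambda>_. x) s))) *
        indicator {0..0} s = 0"
      using AE_lborel_singleton[of "0::real"] by eventually_elim simp
  qed
  finally show ?thesis by simp
qed

context riemannian_manifold
begin

abbreviation gdist :: "'a \<Rightarrow> 'a \<Rightarrow> ennreal" where
  "gdist \<equiv> geodesic_dist M \<A> g"

text \<open>On a compact set of coordinates the entries of the Gram matrix are bounded, so the Riemannian norm
  is bounded by a multiple of the Euclidean norm.\<close>

lemma metric_bound_near:
  assumes c: "c \<in> \<A>" and S: "compact S" "S \<subseteq> snd c ` fst c"
  obtains K where "K > 0" "\<And>z u. z \<in> S \<Longrightarrow>
    sqrt (g (chart_inv c z) (coord_vec \<A> c (chart_inv c z) u) (coord_vec \<A> c (chart_inv c z) u)) \<le> K * norm u"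
proof -
  let ?G = "\<lambda>z. gram_matrix \<A> g c (chart_inv c z)"
  have "continuous_on S (\<lambda>z. (\<chi> i j. ?G z $ i $ j))"
    by (intro continuous_on_vec_lambda continuous_on_subset[OF continuous_on_gram[OF c] S(2)])
  then have "compact (?G ` S)" by (intro compact_continuous_image S) simp
  then obtain B where B: "\<And>z. z \<in> S \<Longrightarrow> norm (?G z) \<le> B"
    by (metis compact_imp_bounded bounded_iff imageI)
  define C where "C = real CARD('n) * real CARD('n) * \<bar>B\<bar> + 1"
  have C: "C > 0" unfolding C_def by (simp add: add_nonneg_pos)
  have "sqrt (g (chart_inv c z) (coord_vec \<A> c (chart_inv c z) u) (coord_vec \<A> c (chart_inv c z) u))
      \<le> sqrt C * norm u" if z: "z \<in> S" for z u
  proof -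
    have x: "chart_inv c z \<in> fst c" using z S c by auto
    have comp: "\<bar>?G z $ i $ j\<bar> \<le> \<bar>B\<bar>" for i j
      using component_le_norm_cart[of "?G z $ i" j] Finite_Cartesian_Product.norm_nth_le[of "?G z" i] B[OF z] by linarith
    have "onorm ((*v) (?G z)) \<le> C"
      using onorm_le_matrix_component[of "?G z" "\<bar>B\<bar>"] comp unfolding C_def by fastforce
    then have "norm (?G z *v u) \<le> C * norm u"
      using onorm[OF matrix_vector_mul_bounded_linear, of "?G z" u]
      by (meson mult_right_mono norm_ge_zero order_trans)
    then have "u \<bullet> (?G z *v u) \<le> C * (norm u)\<^sup>2"
      using Cauchy_Schwarz_ineq2[of u "?G z *v u"] mult_left_mono[of "norm (?G z *v u)" "C * norm u" "norm u"]
      by (simp add: power2_eq_square algebra_simps)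
    then have "sqrt (u \<bullet> (?G z *v u)) \<le> sqrt (C * (norm u)\<^sup>2)" by simp
    then show ?thesis
      using C by (simp add: metric_coord_vec[OF c x] real_sqrt_mult)
  qed
  then show ?thesis using C by (intro that[of "sqrt C"]) auto
qed

definition chart_segment :: "('a, 'n) chart \<Rightarrow> real^'n \<Rightarrow> real^'n \<Rightarrow> real \<Rightarrow> 'a" where
  "chart_segment c z w s = chart_inv c (z + s *\<^sub>R w)"

context
  fixes c z w and I :: "real set"
  assumes c: "c \<in> \<A>" and segment: "\<And>s. s \<in> I \<Longrightarrow> z + s *\<^sub>R w \<in> snd c ` fst c"
begin

lemma chart_segment_in: "s \<in> I \<Longrightarrow> chart_segment c z w s \<in> fst c"
  using segment c by (simp add: chart_segment_def)

text \<open>Seen in another chart \<open>c'\<close>, the segment is the transition map after an affine map, so the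
  chain rule gives its derivative.\<close>

lemma chart_segment_derivative:
  assumes s: "s \<in> I" and c': "c' \<in> \<A>" "chart_segment c z w s \<in> fst c'"
  shows "(snd c' \<circ> chart_segment c z w has_vector_derivative
    frechet_derivative (transition c c') (at (z + s *\<^sub>R w)) w) (at s)"
proof -
  let ?x = "chart_segment c z w s"
  have x: "?x \<in> fst c" "snd c ?x = z + s *\<^sub>R w"
    using segment[OF s] c chart_segment_in[OF s] by (auto simp: chart_segment_def)
  have "((\<lambda>s. z + s *\<^sub>R w) has_vector_derivative w) (at s)"
    by (auto intro!: derivative_eq_intros)
  moreover have "(transition c c' has_derivative frechet_derivative (transition c c') (at (z + s *\<^sub>R w)))
      (at (z + s *\<^sub>R w))"
    using has_derivative_transition[OF c c'(1) x(1) c'(2)] x(2) by simp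
  ultimately have "(transition c c' \<circ> (\<lambda>s. z + s *\<^sub>R w) has_vector_derivative
      frechet_derivative (transition c c') (at (z + s *\<^sub>R w)) w) (at s)"
    by (rule vector_derivative_diff_chain_within[OF _ has_derivative_at_withinI])
  moreover have "snd c' \<circ> chart_segment c z w = transition c c' \<circ> (\<lambda>s. z + s *\<^sub>R w)"
    by (auto simp: chart_segment_def transition_def)
  ultimately show ?thesis by simp
qed

lemma C1_curve_chart_segment:
  assumes "{a..b} \<subseteq> I"
  shows "C1_curve M \<A> a b (chart_segment c z w)"
  unfolding C1_curve_def
proof (intro conjI ballI)
  let ?l = "\<lambda>s. z + s *\<^sub>R w"
  have l: "continuous_on S ?l" for S by (intro continuous_intros)
  have "?l ` {a..b} \<subseteq> snd c ` fst c" using assms by (intro image_subsetI segment) blast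
  then have "continuous_on {a..b} (chart_inv c \<circ> ?l)"
    by (rule continuous_on_compose[OF l continuous_on_subset[OF continuous_on_chart_inv[OF c]]])
  then show "continuous_on {a..b} (chart_segment c z w)"
    by (simp add: chart_segment_def[abs_def] comp_def)
  show "chart_segment c z w ` {a..b} \<subseteq> M"
    using assms chart_subset[OF c] chart_segment_in by (intro image_subsetI) (metis subsetD)
  fix c' assume c': "c' \<in> \<A>"
  let ?S = "{s\<in>{a..b}. chart_segment c z w s \<in> fst c'}"
  let ?D = "\<lambda>s. frechet_derivative (transition c c') (at (?l s)) w"
  have "?l ` ?S \<subseteq> snd c ` (fst c \<inter> fst c')"
  proof (rule image_subsetI)
    fix s assume "s \<in> ?S"
    then have s: "s \<in> I" "chart_segment c z w s \<in> fst c'" using assms by auto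
    have "?l s = snd c (chart_segment c z w s)"
      unfolding chart_segment_def by (rule chart_chart_inv[OF c segment[OF s(1)], symmetric])
    then show "?l s \<in> snd c ` (fst c \<inter> fst c')" using s(2) chart_segment_in[OF s(1)] by blast
  qed
  then have "continuous_on ?S ((\<lambda>y. frechet_derivative (transition c c') (at y) w) \<circ> ?l)"
    by (rule continuous_on_compose[OF l continuous_on_subset[OF continuous_on_frechet_transition[OF c c']]])
  then have "continuous_on ?S ?D" by (simp add: comp_def)
  then show "\<exists>D. continuous_on ?S D \<and> (\<forall>s\<in>{a..b}. chart_segment c z w s \<in> fst c' \<longrightarrow>
      (snd c' \<circ> chart_segment c z w has_vector_derivative D s) (at s within {a..b}))"
  proof (intro exI[of _ ?D] conjI ballI impI)
    fix s assume s: "s \<in> {a..b}" "chart_segment c z w s \<in> fst c'"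
    then have "s \<in> I" using assms by blast
    from has_vector_derivative_at_within[OF chart_segment_derivative[OF this c' s(2)]]
    show "(snd c' \<circ> chart_segment c z w has_vector_derivative ?D s) (at s within {a..b})" .
  qed
qed

text \<open>By \<open>chart_segment_derivative\<close> both sides have the same representation in every chart.\<close>

lemma velocity_chart_segment:
  assumes s: "s \<in> I"
  shows "velocity \<A> (chart_segment c z w) s = coord_vec \<A> c (chart_segment c z w s) w"
proof
  fix c'
  have "snd c (chart_segment c z w s) = z + s *\<^sub>R w"
    using segment[OF s] c by (simp add: chart_segment_def)
  then show "velocity \<A> (chart_segment c z w) s c' = coord_vec \<A> c (chart_segment c z w s) w c'"
    using vector_derivative_at[OF chart_segment_derivative[OF s, of c']]
    by (simp add: velocity_def coord_vec_def charts_at_def)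
qed

end

text \<open>Append to a curve that ends at the point with coordinates \<open>z\<close> the segment from \<open>z\<close> to
  \<open>z + w\<close>, run through in unit time during \<open>{b..b + 1}\<close>, so that a bound \<open>L\<close> for its speed is a
  bound for its length.\<close>

lemma curve_extend_by_segment:
  assumes \<gamma>: "a \<le> b" "piecewise_C1_curve M \<A> a b \<gamma>" "\<gamma> b = chart_inv c z"
    and c: "c \<in> \<A>" and seg: "\<And>s. s \<in> {0..1} \<Longrightarrow> z + s *\<^sub>R w \<in> snd c ` fst c"
    and K: "\<And>s. s \<in> {0..1} \<Longrightarrow>
      sqrt (g (chart_inv c (z + s *\<^sub>R w)) (coord_vec \<A> c (chart_inv c (z + s *\<^sub>R w)) w)
        (coord_vec \<A> c (chart_inv c (z + s *\<^sub>R w)) w)) \<le> L"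
  shows "gdist (\<gamma> a) (chart_inv c (z + w)) \<le> curve_length \<A> g a b \<gamma> + ennreal L"
proof -
  \<comment> \<open>The base point is shifted so that \<open>\<sigma> b\<close> has coordinates \<open>z\<close>.\<close>
  define \<sigma> where "\<sigma> = chart_segment c (z - b *\<^sub>R w) w"
  have \<sigma>: "\<sigma> s = chart_inv c (z + (s - b) *\<^sub>R w)" for s
    by (simp add: \<sigma>_def chart_segment_def algebra_simps)
  have seg_b: "z - b *\<^sub>R w + s *\<^sub>R w \<in> snd c ` fst c" if "s \<in> {b..b+1}" for s
    using seg[of "s - b"] that by (simp add: algebra_simps)
  define \<gamma>' where "\<gamma>' s = (if s \<le> b then \<gamma> s else \<sigma> s)" for s
  have left: "\<gamma>' s = \<gamma> s" if "s \<le> b" for s using that by (simp add: \<gamma>'_def)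
  have right: "\<gamma>' s = \<sigma> s" if "b \<le> s" for s
    using that \<gamma>(3) by (cases "s = b") (auto simp: \<gamma>'_def \<sigma>)
  obtain F where F: "finite F" "\<And>s s'. a \<le> s \<Longrightarrow> s < s' \<Longrightarrow> s' \<le> b \<Longrightarrow> {s<..<s'} \<inter> F = {} \<Longrightarrow> C1_curve M \<A> s s' \<gamma>"
    using \<gamma>(2) unfolding piecewise_C1_curve_def by blast
  have \<sigma>_C1: "C1_curve M \<A> s s' \<sigma>" if "b \<le> s" "s' \<le> b + 1" for s s'
    unfolding \<sigma>_def using that by (intro C1_curve_chart_segment[OF c seg_b, where I="{b..b+1}"]) auto
  have un: "{a..b+1} = {a..b} \<union> {b..b+1}" using \<gamma>(1) by auto
  have pw: "piecewise_C1_curve M \<A> a (b + 1) \<gamma>'"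
    unfolding piecewise_C1_curve_def
  proof (intro conjI exI[of _ "insert b F"] allI impI)
    have "continuous_on {a..b} \<gamma>'" "continuous_on {b..b+1} \<gamma>'"
      using piecewise_C1_curveD(1)[OF \<gamma>(2)] C1_curveD(1)[OF \<sigma>_C1[of b "b+1"]] left right
        continuous_on_eq[of "{a..b}" \<gamma> \<gamma>'] continuous_on_eq[of "{b..b+1}" \<sigma> \<gamma>']
      by simp_all
    then show "continuous_on {a..b+1} \<gamma>'"
      unfolding un by (intro continuous_on_closed_Un) auto
    have "\<gamma>' ` {a..b} \<subseteq> M" using piecewise_C1_curveD(2)[OF \<gamma>(2)] left by auto
    moreover have "\<gamma>' ` {b..b+1} \<subseteq> M"
      using C1_curveD(2)[OF \<sigma>_C1[of b "b+1"]] right by auto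
    ultimately show "\<gamma>' ` {a..b+1} \<subseteq> M" unfolding un by (simp add: image_Un)
    show "finite (insert b F)" using F by simp
    fix s s' assume s: "a \<le> s \<and> s < s' \<and> s' \<le> b + 1 \<and> {s<..<s'} \<inter> insert b F = {}"
    then consider "s' \<le> b" | "b \<le> s" by fastforce
    then show "C1_curve M \<A> s s' \<gamma>'"
    proof cases
      case 1
      then show ?thesis using s left by (intro C1_curve_cong[OF F(2)]) auto
    next
      case 2
      then show ?thesis using s right by (intro C1_curve_cong[OF \<sigma>_C1]) auto
    qed
  qed
  have "\<gamma>' a = \<gamma> a" "\<gamma>' (b + 1) = chart_inv c (z + w)"
    using \<gamma>(1) by (simp_all add: left right \<sigma>)
  then have "gdist (\<gamma> a) (chart_inv c (z + w)) \<le> curve_length \<A> g a (b + 1) \<gamma>'"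
    unfolding geodesic_dist_def using pw \<gamma>(1)
    by (intro Inf_lower CollectI exI[of _ a] exI[of _ "b + 1"] exI[of _ \<gamma>']) simp
  also have "\<dots> \<le> curve_length \<A> g a b \<gamma> + ennreal L"
  proof -
    define sp where "sp \<gamma> s = ennreal (sqrt (g (\<gamma> s) (velocity \<A> \<gamma> s) (velocity \<A> \<gamma> s)))"
      for \<gamma> and s :: real
    have len: "curve_length \<A> g r t \<delta> = (\<integral>\<^sup>+s\<in>{r..t}. sp \<delta> s \<partial>lborel)" for r t \<delta>
      by (simp add: curve_length_def sp_def)
    have sp_left: "sp \<gamma>' s = sp \<gamma> s" if "s < b" for s
      using velocity_cong[of "{..<b}" s \<gamma>' \<gamma> \<A>] that left by (simp add: sp_def)
    have sp_right: "sp \<gamma>' s \<le> ennreal L" if "b < s" "s < b + 1" for s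
    proof -
      have "velocity \<A> \<gamma>' s = velocity \<A> \<sigma> s"
        using velocity_cong[of "{b<..}" s \<gamma>' \<sigma> \<A>] that right by simp
      also have "\<dots> = coord_vec \<A> c (\<sigma> s) w"
        unfolding \<sigma>_def using that by (intro velocity_chart_segment[OF c seg_b, where I="{b..b+1}"]) auto
      finally show ?thesis
        using K[of "s - b"] that right[of s] by (simp add: sp_def \<sigma> ennreal_leI)
    qed
    have "curve_length \<A> g a (b + 1) \<gamma>' \<le>
        (\<integral>\<^sup>+s. sp \<gamma>' s * indicator {a..b+1} s * indicator {..b} s \<partial>lborel) +
        (\<integral>\<^sup>+s. sp \<gamma>' s * indicator {a..b+1} s * indicator (- {..b}) s \<partial>lborel)"
      unfolding len by (rule nn_integral_le_split) simp
    \<comment> \<open>At the break point \<open>b\<close> and at the end point the velocity is uncontrolled; both are null sets.\<close>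
    also have "\<dots> \<le> (\<integral>\<^sup>+s\<in>{a..b}. sp \<gamma> s \<partial>lborel) + (\<integral>\<^sup>+s. ennreal L * indicator {b..b+1} s \<partial>lborel)"
    proof (intro add_mono nn_integral_mono_AE)
      show "AE s in lborel. sp \<gamma>' s * indicator {a..b+1} s * indicator {..b} s \<le> sp \<gamma> s * indicator {a..b} s"
        using AE_lborel_singleton[of b] by eventually_elim (auto simp: indicator_def sp_left)
      show "AE s in lborel. sp \<gamma>' s * indicator {a..b+1} s * indicator (- {..b}) s \<le> ennreal L * indicator {b..b+1} s"
        using AE_lborel_singleton[of "b+1"] by eventually_elim (auto simp: indicator_def sp_right)
    qed
    also have "\<dots> = curve_length \<A> g a b \<gamma> + ennreal L"
      by (simp add: len nn_integral_cmult_indicator)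
    finally show ?thesis .
  qed
  finally show ?thesis .
qed

text \<open>Upper semicontinuity of \<open>gdist x\<close>: a curve from \<open>x\<close> to \<open>y\<close> of length less than \<open>r\<close> has
  some length \<open>e\<close> to spare, which pays for a short segment from \<open>y\<close> to any point close to it.\<close>

lemma openin_gdist_less: "openin (top_of_set M) {y\<in>M. gdist x y < r}"
proof (subst openin_subopen, intro ballI)
  fix y assume "y \<in> {y\<in>M. gdist x y < r}"
  then have y: "y \<in> M" "gdist x y < r" by auto
  then obtain a b \<gamma> where \<gamma>: "a \<le> b" "piecewise_C1_curve M \<A> a b \<gamma>" "\<gamma> a = x" "\<gamma> b = y"
      "curve_length \<A> g a b \<gamma> < r"
    unfolding geodesic_dist_def Inf_less_iff by auto
  obtain e where e: "e > 0" "curve_length \<A> g a b \<gamma> + ennreal e < r"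
  proof -
    obtain q where q: "curve_length \<A> g a b \<gamma> < q" "q < r" using dense[OF \<gamma>(5)] by blast
    then obtain l q' where l: "curve_length \<A> g a b \<gamma> = ennreal l" "0 \<le> l" "q = ennreal q'" "0 \<le> q'"
      by (cases "curve_length \<A> g a b \<gamma>"; cases q) auto
    then have "ennreal l + ennreal (q' - l) = q" "l < q'"
      using q by (auto simp: ennreal_plus[symmetric] ennreal_less_iff simp del: ennreal_plus)
    then show ?thesis using that[of "q' - l"] q l by simp
  qed
  obtain c where c: "c \<in> \<A>" "y \<in> fst c" using in_chart y by blast
  let ?z = "snd c y"
  obtain \<rho> where \<rho>: "\<rho> > 0" "cball ?z \<rho> \<subseteq> snd c ` fst c"
    using open_chart_image[OF c(1)] c(2) open_contains_cball by blast
  obtain K where K: "K > 0" "\<And>z u. z \<in> cball ?z \<rho> \<Longrightarrow>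
      sqrt (g (chart_inv c z) (coord_vec \<A> c (chart_inv c z) u) (coord_vec \<A> c (chart_inv c z) u)) \<le> K * norm u"
    using metric_bound_near[OF c(1) compact_cball \<rho>(2)] by blast
  \<comment> \<open>Segments stay in the ball where \<open>K\<close> bounds the metric, and cost at most \<open>K * \<delta> \<le> e\<close>.\<close>
  define \<delta> where "\<delta> = min \<rho> (e / K)"
  have \<delta>: "\<delta> > 0" "\<delta> \<le> \<rho>" "\<And>t. t < \<delta> \<Longrightarrow> K * t \<le> e"
    using \<rho> e K by (auto simp: \<delta>_def field_simps)
  let ?W = "chart_inv c ` ball ?z \<delta>"
  have ball: "ball ?z \<delta> \<subseteq> snd c ` fst c" using \<rho>(2) \<delta>(2) by force
  have "gdist x (chart_inv c v) < r" if v: "v \<in> ball ?z \<delta>" for v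
  proof -
    let ?w = "v - ?z"
    have w: "norm ?w < \<delta>" using v by (simp add: dist_norm norm_minus_commute)
    have in_cball: "?z + s *\<^sub>R ?w \<in> cball ?z \<rho>" if "s \<in> {0..1}" for s
    proof -
      have "norm (s *\<^sub>R ?w) \<le> norm ?w" using that by (simp add: mult_left_le_one_le)
      then show ?thesis using w \<delta>(2) by (simp add: dist_norm)
    qed
    have "gdist (\<gamma> a) (chart_inv c (?z + ?w)) \<le> curve_length \<A> g a b \<gamma> + ennreal (K * norm ?w)"
    proof (rule curve_extend_by_segment[OF \<gamma>(1,2) _ c(1)])
      show "\<gamma> b = chart_inv c ?z" using c \<gamma>(4) by simp
      show "?z + s *\<^sub>R ?w \<in> snd c ` fst c" if "s \<in> {0..1}" for s
        using in_cball[OF that] \<rho>(2) by blast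
    qed (rule K(2)[OF in_cball])
    also have "\<dots> \<le> curve_length \<A> g a b \<gamma> + ennreal e"
      using \<delta>(3)[OF w] by (intro add_left_mono ennreal_leI)
    finally show ?thesis using e(2) \<gamma>(3) by simp
  qed
  moreover have "?W \<subseteq> M" using ball chart_subset[OF c(1)] c(1) by force
  moreover have "openin (top_of_set M) ?W"
    using ball by (intro openin_chart_inv_image c) auto
  moreover have "y \<in> ?W" using c \<delta> by (intro image_eqI[of _ _ ?z]) auto
  ultimately show "\<exists>T. openin (top_of_set M) T \<and> y \<in> T \<and> T \<subseteq> {y\<in>M. gdist x y < r}"
    by (intro exI[of _ ?W]) auto
qed

end

section \<open>The weight is determined by the operator\<close>

lemma gauss_kernel_pos: "d < \<infinity> \<Longrightarrow> gauss_kernel t d > 0"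
  by (simp add: gauss_kernel_def)

lemma gauss_kernel_bounds: "t > 0 \<Longrightarrow> 0 \<le> gauss_kernel t d \<and> gauss_kernel t d \<le> 1"
  by (simp add: gauss_kernel_def)

lemma borel_measurable_gauss_kernel[measurable]: "gauss_kernel t \<in> borel_measurable borel"
  unfolding gauss_kernel_def[abs_def] by measurable

context compact_riemannian_manifold
begin

lemma measurable_vol_continuous: "continuous_on M f \<Longrightarrow> f \<in> borel_measurable vol"
  using borel_measurable_continuous_on_restrict[of M f] by (simp add: measurable_cong_sets[OF sets_vol refl])

lemma measurable_vol_gdist: "gdist x \<in> borel_measurable vol"
proof (rule borel_measurableI_less)
  show "{y \<in> space vol. gdist x y < r} \<in> sets vol" for r
    unfolding space_vol sets_vol by (rule sets_borel_M_openin[OF openin_gdist_less])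
qed

text \<open>A chart would turn an isolated point into an open singleton of \<open>real ^ 'n\<close>.\<close>

lemma not_isolated:
  assumes U: "openin (top_of_set M) U" "x \<in> U"
  shows "\<exists>y\<in>U. y \<noteq> x"
proof (rule ccontr)
  assume "\<not> ?thesis"
  then have "U = {x}" using U(2) by blast
  obtain c where c: "c \<in> \<A>" "x \<in> fst c" using in_chart openin_imp_subset[OF U(1)] U(2) by blast
  have "open (snd c ` U)" using U c \<open>U = {x}\<close> by (intro open_image_of_openin) auto
  then show False using not_open_singleton[of "snd c x"] \<open>U = {x}\<close> by simp
qed

text \<open>Urysohn's lemma in the compact Hausdorff space \<open>M\<close>, separating \<open>{x} \<union> (M - U)\<close> from a second point
  of \<open>U\<close>.\<close>

lemma bump_function:
  assumes U: "openin (top_of_set M) U" "x \<in> U"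
  obtains f :: "'a \<Rightarrow> real" and y where "continuous_on M f" "\<And>z. z \<in> M \<Longrightarrow> 0 \<le> f z \<and> f z \<le> 1"
    "f x = 0" "\<And>z. z \<in> M - U \<Longrightarrow> f z = 0" "y \<in> M" "f y = 1"
proof -
  obtain y where y: "y \<in> U" "y \<noteq> x" using not_isolated[OF U] by blast
  have M: "U \<subseteq> M" using openin_imp_subset[OF U(1)] .
  have "normal_space (top_of_set M)"
  proof (rule compact_Hausdorff_or_regular_imp_normal_space[OF _ disjI1])
    show "compact_space (top_of_set M)" using compact_M by (simp add: compact_space_subtopology)
    have "Hausdorff_space (euclidean :: 'a topology)"
      unfolding Hausdorff_space_def using hausdorff[where 'a='a] by (simp add: disjnt_def) 
    then show "Hausdorff_space (top_of_set M)" by (rule Hausdorff_space_subtopology)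
  qed
  moreover have sing: "closedin (top_of_set M) {z}" if "z \<in> M" for z
    using that by (intro closed_subset) auto
  moreover have "closedin (top_of_set M) ({x} \<union> (M - U))"
    using U M sing by (intro closedin_Un) auto
  moreover have "disjnt ({x} \<union> (M - U)) {y}" using y by auto
  ultimately obtain f where f: "continuous_map (top_of_set M) (top_of_set {0..1::real}) f"
      "f ` ({x} \<union> (M - U)) \<subseteq> {0}" "f ` {y} \<subseteq> {1}"
    using Urysohn_lemma[of "top_of_set M" "{x} \<union> (M - U)" "{y}" 0 1] y M by (metis subsetD zero_le_one)
  show ?thesis
  proof (rule that[of f y])
    show "continuous_on M f" using f(1) by (simp add: continuous_map_in_subtopology)
    show "0 \<le> f z \<and> f z \<le> 1" if "z \<in> M" for z
      using f(1) that by (auto simp: continuous_map_in_subtopology image_subset_iff)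
  qed (use f(2,3) y M in auto)
qed

text \<open>The heart of the proof. The neighbourhood \<open>U\<close> of \<open>x\<close> is chosen such that \<open>p1 - p2\<close> is positive,
  the kernel is positive, and the volume is finite; the last makes both integrals absolutely
  convergent for \<open>f\<close> supported in \<open>U\<close>, so that they may be subtracted.\<close>

lemma weight_le:
  assumes t: "t > 0"
    and p1: "continuous_on M p1" and p2: "continuous_on M p2"
    and eq: "\<And>f x. continuous_on M f \<Longrightarrow> x \<in> M \<Longrightarrow>
      kernel_laplacian M \<A> g t p1 f x = kernel_laplacian M \<A> g t p2 f x"
    and x: "x \<in> M"
  shows "p1 x \<le> p2 x"
proof (rule ccontr)
  assume "\<not> p1 x \<le> p2 x"
  then have qx: "p1 x - p2 x > 0" by simp
  obtain W where W: "openin (top_of_set M) W" "x \<in> W" "emeasure vol W < \<infinity>"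
    using locally_finite_vol[OF x] by blast
  define P where "P = {y\<in>M. p1 y - p2 y \<in> {0<..}}"
  define U where "U = W \<inter> ({y\<in>M. gdist x y < \<infinity>} \<inter> P)"
  have "openin (top_of_set M) P"
    using continuous_openin_preimage_gen[OF continuous_on_diff[OF p1 p2], of "{0<..}"]
    by (simp add: P_def vimage_def Int_def)
  then have U_open: "openin (top_of_set M) U"
    unfolding U_def by (intro openin_Int W openin_gdist_less)
  have xU: "x \<in> U" using x W qx by (simp add: U_def P_def geodesic_dist_self)
  have sets_open: "V \<in> sets vol" if "openin (top_of_set M) V" for V
    using sets_borel_M_openin[OF that] by (simp add: sets_vol)
  have U_fin: "emeasure vol U < \<infinity>"
    using emeasure_mono[of U W vol] sets_open[OF W(1)] W(3) by (auto simp: U_def intro: le_less_trans)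
  obtain f :: "'a \<Rightarrow> real" and y where f: "continuous_on M f" "\<And>z. z \<in> M \<Longrightarrow> 0 \<le> f z \<and> f z \<le> 1"
    "f x = 0" "\<And>z. z \<in> M - U \<Longrightarrow> f z = 0" "y \<in> M" "f y = 1"
    using bump_function[OF U_open xU] by blast
  define k where "k y = gauss_kernel t (gdist x y)" for y
  have k_meas: "k \<in> borel_measurable vol"
    unfolding k_def by (rule measurable_compose[OF measurable_vol_gdist borel_measurable_gauss_kernel])
  have k_bounds: "0 \<le> k y" "k y \<le> 1" for y
    using gauss_kernel_bounds[OF t] by (auto simp: k_def)
  have int: "integrable vol (\<lambda>y. k y * (f x - f y) * p y)" if p: "continuous_on M p" for p
  proof -
    obtain B where B: "\<And>z. z \<in> M \<Longrightarrow> \<bar>p z\<bar> \<le> B"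
      using compact_imp_bounded[OF compact_continuous_image[OF p compact_M]]
      by (metis bounded_iff imageI real_norm_def)
    have "integrable vol (\<lambda>y. B * indicator U y)"
      using U_fin sets_open[OF U_open] by (intro integrable_mult_right integrable_real_indicator)
    then show ?thesis
    proof (rule Bochner_Integration.integrable_bound)
      show "(\<lambda>y. k y * (f x - f y) * p y) \<in> borel_measurable vol"
        using k_meas measurable_vol_continuous[OF f(1)] measurable_vol_continuous[OF p] by measurable
      have "norm (k y * (f x - f y) * p y) \<le> norm (B * indicator U y)" if y: "y \<in> M" for y
      proof (cases "y \<in> U")
        case True
        have "k y * f y \<le> 1" using k_bounds f(2)[OF y] by (simp add: mult_le_one)
        then have "(k y * f y) * \<bar>p y\<bar> \<le> 1 * B"
          using B[OF y] k_bounds f(2)[OF y] by (intro mult_mono) auto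
        then show ?thesis using True k_bounds[of y] f(2)[OF y] by (simp add: f(3) abs_mult)
      next
        case False
        then show ?thesis using f(3) f(4)[of y] y by simp
      qed
      then show "AE y in vol. norm (k y * (f x - f y) * p y) \<le> norm (B * indicator U y)"
        by (intro AE_I2) (simp add: space_vol)
    qed
  qed
  let ?h = "\<lambda>y. k y * f y * (p1 y - p2 y)"
  have h: "?h = (\<lambda>y. k y * (f x - f y) * p2 y - k y * (f x - f y) * p1 y)"
    by (simp add: f(3) algebra_simps)
  have "(\<integral>y. k y * (f x - f y) * p1 y \<partial>vol) = (\<integral>y. k y * (f x - f y) * p2 y \<partial>vol)"
    using eq[OF f(1) x] t by (simp add: kernel_laplacian_def k_def)
  then have "(\<integral>y. ?h y \<partial>vol) = 0" and h_int: "integrable vol ?h"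
    unfolding h using int[OF p1] int[OF p2] by simp_all
  moreover have "AE y in vol. 0 \<le> ?h y"
  proof (intro AE_I2)
    fix z assume "z \<in> space vol"
    then have z: "z \<in> M" by (simp add: space_vol)
    show "0 \<le> ?h z"
    proof (cases "z \<in> U")
      case True
      then show ?thesis using k_bounds f(2)[OF z] by (simp add: U_def P_def)
    next
      case False
      then show ?thesis using f(4) z by simp
    qed
  qed
  ultimately have AE0: "AE y in vol. ?h y = 0"
    using integral_nonneg_eq_0_iff_AE[of vol ?h] by blast
  let ?V = "{z\<in>M. f z \<in> {0<..}}"
  have V: "openin (top_of_set M) ?V"
    using continuous_openin_preimage_gen[OF f(1), of "{0<..}"] by (simp add: vimage_def Int_def)
  have "?h z \<noteq> 0" if "z \<in> ?V" for z
  proof -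
    have "z \<in> U" using that f(4)[of z] by force
    then have "k z > 0" "p1 z - p2 z > 0" by (simp_all add: k_def U_def P_def gauss_kernel_pos)
    then show ?thesis using that by simp
  qed
  then have "AE z in vol. z \<notin> ?V" by (intro eventually_mono[OF AE0]) blast
  then have "emeasure vol ?V = 0"
    using sets_open[OF V] by (simp add: AE_iff_null_sets null_setsD1)
  moreover have "y \<in> ?V" using f by simp
  ultimately show False using emeasure_vol_open_pos[OF V] by force
qed

end

theorem theorem2p3:
  fixes M :: "'a::t2_space set"
    and \<A> :: "('a, 'n::finite) chart set"
    and g :: "('a, 'n) metric"
    and t :: real
    and p1 p2 :: "'a \<Rightarrow> real"
  assumes "smooth_manifold M \<A>"
    and "compact M"
    and "Ck_riemannian_metric 2 M \<A> g"
    and "t > 0"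
    and "continuous_on M p1" and "\<forall>x\<in>M. p1 x > 0"
    and "continuous_on M p2" and "\<forall>x\<in>M. p2 x > 0"
    and "\<forall>f. continuous_on M f \<longrightarrow>
           (\<forall>x\<in>M. kernel_laplacian M \<A> g t p1 f x = kernel_laplacian M \<A> g t p2 f x)"
  shows "\<forall>x\<in>M. p1 x = p2 x"
proof -
  interpret compact_riemannian_manifold M \<A> g
    using assms(1-3) Ck_riemannian_metric_0 by unfold_locales auto
  show ?thesis
    using weight_le[OF assms(4,5,7)] weight_le[OF assms(4,7,5)] assms(9) by (metis order_antisym)
qed

end
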